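(* Let $0<\alpha<1$, $T>0$ and $u_0\in H$. If the weak solution $u$ to $$\mathrm{i}^\alpha\partial_t^\alpha u(t)+Au(t)=0,\quad t\in(0,T),\qquad u(0)=u_0,$$ satisfies $u(T)=0$, then $u_0=0$ and hence $u(t)=0$ for all $t\in[0,T]$.
   Context: $(H,\langle\cdot,\cdot\rangle)$ is a complex Hilbert space with norm $\|\cdot\|$; $A:D(A)\subset H\to H$ is a negative-definite self-adjoint operator with compact resolvent. The eigenvalues of $-A$ are $0<\lambda_1\le\lambda_2\le\cdots\to\infty$, with a corresponding orthonormal (Hilbert) basis of eigenvectors $\{\varphi_n\}_{n\ge1}\subset D(A)$. For $s\ge0$, $H_s=\{u\in H:\sum_n\lambda_n^{2s}|\langle u,\varphi_n\rangle|^2<\infty\}$ with $\|u\|_s^2=\sum_n\lambda_n^{2s}|\langle u,\varphi_n\rangle|^2$; $H_{-s}=H_s'$ is its dual (identifying $H=H'$) with norm $\|u\|_{-s}^2=\sum_n\lambda_n^{-2s}|\langle u,\varphi_n\rangle_{-s,s}|^2$. Powers: $\mathrm{i}^{\alpha}=e^{\mathrm{i}\pi\alpha/2}$, $\mathrm{i}^{-\alpha}=e^{-\mathrm{i}\pi\alpha/2}$. Caputo derivative for $0<\alpha<1$: $\partial_t^\alpha u(t)=\frac{1}{\Gamma(1-\alpha)}\int_0^t(t-s)^{-\alpha}\partial_su(s)\,\mathrm{d}s$, understood coefficientwise for $u(t)=\sum_nu_n(t)\varphi_n$ with $u_n$ absolutely continuous on $[0,T]$. Weak solution for $u_0\in H$: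 a function $u$ such that (1) $u\in C([0,T];H)$; (2) $\partial_t^\alpha u(t),Au(t)\in H_{-1/\alpha}$ for almost all $t\in(0,T)$ and the equation holds in $H_{-1/\alpha}$ for almost all $t$; (3) $\lim_{t\to0^+}\|u(t)-u_0\|=0$. For each $u_0\in H$ there is exactly one weak solution, given by $u(t)=\sum_n\langle u_0,\varphi_n\rangle E_{\alpha,1}(\mathrm{i}^{-\alpha}\lambda_nt^\alpha)\varphi_n$, where $E_{\alpha,\beta}(z)=\sum_{k\ge0}z^k/\Gamma(\alpha k+\beta)$ is the Mittag-Leffler function. *)

theory Defs
  imports "HOL-Analysis.Analysis"
begin

text \<open>Complex Hilbert spaces. The inner product is linear in its first argument and
  conjugate-linear in its second; completeness comes from \<^class>\<open>banach\<close>.\<close>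

class complex_hilbert = banach +
  fixes scaleC :: "complex \<Rightarrow> 'a \<Rightarrow> 'a" (infixr \<open>*\<^sub>C\<close> 75)
    and cinner :: "'a \<Rightarrow> 'a \<Rightarrow> complex"
  assumes scaleC_add_right: "c *\<^sub>C (x + y) = c *\<^sub>C x + c *\<^sub>C y"
    and scaleC_add_left: "(c + d) *\<^sub>C x = c *\<^sub>C x + d *\<^sub>C x"
    and scaleC_scaleC: "c *\<^sub>C (d *\<^sub>C x) = (c * d) *\<^sub>C x"
    and scaleC_one: "1 *\<^sub>C x = x"
    and scaleR_scaleC: "r *\<^sub>R x = complex_of_real r *\<^sub>C x"
    and cinner_commute: "cinner x y = cnj (cinner y x)"
    and cinner_add_left: "cinner (x + y) z = cinner x z + cinner y z"
    and cinner_scaleC_left: "cinner (c *\<^sub>C x) y = c * cinner x y"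
    and cinner_self: "cinner x x = complex_of_real ((norm x)\<^sup>2)"

section \<open>Unbounded operators\<close>

text \<open>An unbounded operator is a pair of a domain \<open>D\<close> and a map \<open>A\<close> whose values outside \<open>D\<close>
  are irrelevant.\<close>

definition csubspace :: "'a::complex_hilbert set \<Rightarrow> bool" where
  "csubspace D \<longleftrightarrow> 0 \<in> D \<and> (\<forall>x\<in>D. \<forall>y\<in>D. x + y \<in> D) \<and> (\<forall>c. \<forall>x\<in>D. c *\<^sub>C x \<in> D)"

definition clinear_on :: "'a::complex_hilbert set \<Rightarrow> ('a \<Rightarrow> 'a) \<Rightarrow> bool" where
  "clinear_on D A \<longleftrightarrow>
     (\<forall>x\<in>D. \<forall>y\<in>D. A (x + y) = A x + A y) \<and> (\<forall>c. \<forall>x\<in>D. A (c *\<^sub>C x) = c *\<^sub>C A x)"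

definition op_graph :: "'a::complex_hilbert set \<Rightarrow> ('a \<Rightarrow> 'a) \<Rightarrow> ('a \<times> 'a) set" where
  "op_graph D A = {(x, A x) | x. x \<in> D}"

definition adjoint_graph :: "'a::complex_hilbert set \<Rightarrow> ('a \<Rightarrow> 'a) \<Rightarrow> ('a \<times> 'a) set" where
  "adjoint_graph D A = {(v, w). \<forall>x\<in>D. cinner (A x) v = cinner x w}"

definition self_adjoint :: "'a::complex_hilbert set \<Rightarrow> ('a \<Rightarrow> 'a) \<Rightarrow> bool" where
  "self_adjoint D A \<longleftrightarrow>
     csubspace D \<and> closure D = UNIV \<and> clinear_on D A \<and> adjoint_graph D A = op_graph D A"

text \<open>For a self-adjoint operator the quadratic form below is real-valued.\<close>

definition negative_definite :: "'a::complex_hilbert set \<Rightarrow> ('a \<Rightarrow> 'a) \<Rightarrow> bool" where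
  "negative_definite D A \<longleftrightarrow> (\<forall>x\<in>D. x \<noteq> 0 \<longrightarrow> Re (cinner (A x) x) < 0)"

definition is_resolvent_at ::
  "'a::complex_hilbert set \<Rightarrow> ('a \<Rightarrow> 'a) \<Rightarrow> complex \<Rightarrow> ('a \<Rightarrow> 'a) \<Rightarrow> bool" where
  "is_resolvent_at D A z R \<longleftrightarrow>
     (\<forall>x. R x \<in> D \<and> z *\<^sub>C R x - A (R x) = x) \<and> (\<forall>x\<in>D. R (z *\<^sub>C x - A x) = x)"

definition compact_resolvent :: "'a::complex_hilbert set \<Rightarrow> ('a \<Rightarrow> 'a) \<Rightarrow> bool" where
  "compact_resolvent D A \<longleftrightarrow>
     (\<exists>z R. is_resolvent_at D A z R \<and> compact (closure (R ` cball 0 1)))"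

text \<open>The eigenvalues of \<open>-A\<close>, repeated according to multiplicity and in increasing order, with
  an orthonormal Hilbert basis of eigenvectors. The enumeration starts at \<open>0\<close>.\<close>

definition eigenbasis ::
  "'a::complex_hilbert set \<Rightarrow> ('a \<Rightarrow> 'a) \<Rightarrow> (nat \<Rightarrow> real) \<Rightarrow> (nat \<Rightarrow> 'a) \<Rightarrow> bool" where
  "eigenbasis D A lam \<phi> \<longleftrightarrow>
     0 < lam 0 \<and> mono lam \<and> filterlim lam at_top sequentially \<and>
     (\<forall>n. \<phi> n \<in> D \<and> - A (\<phi> n) = lam n *\<^sub>R \<phi> n) \<and>
     (\<forall>m n. cinner (\<phi> m) (\<phi> n) = (if m = n then 1 else 0)) \<and>
     (\<forall>x. (\<lambda>n. cinner x (\<phi> n) *\<^sub>C \<phi> n) sums x)"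

section \<open>The scale of spaces \<open>H\<^sub>s\<close> and their duals\<close>

definition Hs :: "(nat \<Rightarrow> real) \<Rightarrow> (nat \<Rightarrow> 'a::complex_hilbert) \<Rightarrow> real \<Rightarrow> 'a set" where
  "Hs lam \<phi> s = {u. summable (\<lambda>n. lam n powr (2 * s) * (cmod (cinner u (\<phi> n)))\<^sup>2)}"

definition Hs_norm :: "(nat \<Rightarrow> real) \<Rightarrow> (nat \<Rightarrow> 'a::complex_hilbert) \<Rightarrow> real \<Rightarrow> 'a \<Rightarrow> real" where
  "Hs_norm lam \<phi> s u = sqrt (\<Sum>n. lam n powr (2 * s) * (cmod (cinner u (\<phi> n)))\<^sup>2)"

text \<open>The dual space \<open>H\<^sub>-\<^sub>s\<close> for \<open>s \<ge> 0\<close>. Its elements are the bounded conjugate-linear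
  functionals, so that the identification of \<open>u \<in> H\<close> with \<open>v \<mapsto> \<langle>u, v\<rangle>\<close> is complex-linear; the
  pairing \<open>\<langle>F, v\<rangle>\<close> between \<open>H\<^sub>-\<^sub>s\<close> and \<open>H\<^sub>s\<close> is \<open>F v\<close>. Functionals on \<open>H\<^sub>s\<close> are represented by
  total functions vanishing outside \<open>H\<^sub>s\<close>, so that equality in \<open>H\<^sub>-\<^sub>s\<close> is equality of functions.\<close>

definition Hs_dual ::
  "(nat \<Rightarrow> real) \<Rightarrow> (nat \<Rightarrow> 'a::complex_hilbert) \<Rightarrow> real \<Rightarrow> ('a \<Rightarrow> complex) set" where
  "Hs_dual lam \<phi> s = {F.
     (\<forall>v\<in>Hs lam \<phi> s. \<forall>w\<in>Hs lam \<phi> s. F (v + w) = F v + F w) \<and>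
     (\<forall>c. \<forall>v\<in>Hs lam \<phi> s. F (c *\<^sub>C v) = cnj c * F v) \<and>
     (\<exists>C. \<forall>v\<in>Hs lam \<phi> s. cmod (F v) \<le> C * Hs_norm lam \<phi> s v) \<and>
     (\<forall>v. v \<notin> Hs lam \<phi> s \<longrightarrow> F v = 0)}"

text \<open>For \<open>u \<in> H\<close>, possibly outside \<open>D(A)\<close>, the element \<open>A u\<close> of \<open>H\<^sub>-\<^sub>s\<close> with \<open>s \<ge> 1\<close> is
  obtained by extending the self-adjoint \<open>A\<close> by duality: \<open>\<langle>A u, v\<rangle> = \<langle>u, A v\<rangle>\<close> for
  \<open>v \<in> H\<^sub>s \<subseteq> H\<^sub>1 = D(A)\<close>. Its coefficients are \<open>\<langle>A u, \<phi>\<^sub>n\<rangle> = - \<lambda>\<^sub>n \<langle>u, \<phi>\<^sub>n\<rangle>\<close>.\<close>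

definition extended_op ::
  "(nat \<Rightarrow> real) \<Rightarrow> (nat \<Rightarrow> 'a::complex_hilbert) \<Rightarrow> real \<Rightarrow> ('a \<Rightarrow> 'a) \<Rightarrow> 'a \<Rightarrow> ('a \<Rightarrow> complex)"
  where
  "extended_op lam \<phi> s A u = (\<lambda>v. if v \<in> Hs lam \<phi> s then cinner u (A v) else 0)"

section \<open>The Caputo derivative\<close>

definition absolutely_continuous_fun_on :: "real \<Rightarrow> real \<Rightarrow> (real \<Rightarrow> complex) \<Rightarrow> bool" where
  "absolutely_continuous_fun_on a b f \<longleftrightarrow>
     (\<forall>\<epsilon>>0. \<exists>\<delta>>0. \<forall>d S. d division_of S \<and> S \<subseteq> {a..b} \<and> (\<Sum>K\<in>d. Sup K - Inf K) < \<delta> \<longrightarrow>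
        (\<Sum>K\<in>d. cmod (f (Sup K) - f (Inf K))) < \<epsilon>)"

definition caputo_integrand :: "real \<Rightarrow> (real \<Rightarrow> complex) \<Rightarrow> real \<Rightarrow> real \<Rightarrow> complex" where
  "caputo_integrand \<alpha> f t s = (t - s) powr (- \<alpha>) *\<^sub>R vector_derivative f (at s)"

text \<open>For absolutely continuous \<open>f\<close> the integrability holds for almost every \<open>t\<close>.\<close>

definition has_caputo_derivative ::
  "real \<Rightarrow> (real \<Rightarrow> complex) \<Rightarrow> real \<Rightarrow> complex \<Rightarrow> bool" where
  "has_caputo_derivative \<alpha> f t d \<longleftrightarrow>
     set_integrable lebesgue {0..t} (caputo_integrand \<alpha> f t) \<and>
     d = (1 / Gamma (1 - \<alpha>)) *\<^sub>R (LINT s:{0..t}|lebesgue. caputo_integrand \<alpha> f t s)"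

text \<open>\<open>F\<close> is the coefficientwise Caputo derivative at time \<open>t\<close> of the \<open>H\<close>-valued function \<open>u\<close>
  as an element of \<open>H\<^sub>-\<^sub>s\<close>.\<close>

definition has_caputo_derivative_in_dual ::
  "(nat \<Rightarrow> real) \<Rightarrow> (nat \<Rightarrow> 'a::complex_hilbert) \<Rightarrow> real \<Rightarrow> real \<Rightarrow>
   (real \<Rightarrow> 'a) \<Rightarrow> real \<Rightarrow> ('a \<Rightarrow> complex) \<Rightarrow> bool" where
  "has_caputo_derivative_in_dual lam \<phi> s \<alpha> u t F \<longleftrightarrow>
     F \<in> Hs_dual lam \<phi> s \<and>
     (\<forall>n. has_caputo_derivative \<alpha> (\<lambda>\<tau>. cinner (u \<tau>) (\<phi> n)) t (F (\<phi> n)))"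

section \<open>Weak solutions\<close>

definition i_power :: "real \<Rightarrow> complex" where
  "i_power \<alpha> = exp (\<i> * complex_of_real (pi * \<alpha> / 2))"

definition weak_solution ::
  "('a \<Rightarrow> 'a) \<Rightarrow> (nat \<Rightarrow> real) \<Rightarrow> (nat \<Rightarrow> 'a::complex_hilbert) \<Rightarrow>
   real \<Rightarrow> real \<Rightarrow> 'a \<Rightarrow> (real \<Rightarrow> 'a) \<Rightarrow> bool" where
  "weak_solution A lam \<phi> \<alpha> T u0 u \<longleftrightarrow>
     continuous_on {0..T} u \<and>
     (\<forall>n. absolutely_continuous_fun_on 0 T (\<lambda>t. cinner (u t) (\<phi> n))) \<and>
     (AE t in lebesgue. t \<in> {0<..<T} \<longrightarrow>
        (\<exists>F. has_caputo_derivative_in_dual lam \<phi> (1 / \<alpha>) \<alpha> u t F \<and>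
             extended_op lam \<phi> (1 / \<alpha>) A (u t) \<in> Hs_dual lam \<phi> (1 / \<alpha>) \<and>
             (\<lambda>v. i_power \<alpha> * F v + extended_op lam \<phi> (1 / \<alpha>) A (u t) v) = (\<lambda>v. 0))) \<and>
     ((\<lambda>t. norm (u t - u0)) \<longlongrightarrow> 0) (at_right 0)"

end

theory Submission
  imports Defs "HOL-Complex_Analysis.Complex_Analysis"
begin

text \<open>Each coefficient \<open>f(t) = \<langle>u(t), \<phi>\<^sub>n\<rangle>\<close> satisfies \<open>\<i>\<^sup>\<alpha> \<partial>\<^sup>\<alpha> f = \<lambda>\<^sub>n f\<close>. The rotation by
  \<open>\<i>\<^sup>\<alpha>\<close> makes the fractional integration kernel \<open>t\<^sup>-\<^sup>\<alpha>\<close> exactly the boundary value of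
  \<open>(\<epsilon> - \<i> t)\<^sup>-\<^sup>\<alpha>\<close>, which is positive definite. Testing the equation with \<open>f'\<close> therefore gives
  \<open>0 \<le> Re \<integral> f' cnj f = (|f(T)|\<^sup>2 - |f(0)|\<^sup>2) / 2\<close>, so \<open>|f(0)| \<le> |f(T)|\<close> and \<open>f(T) = 0\<close> forces
  \<open>f(0) = 0\<close>. Convolution with \<open>t\<^sup>\<alpha>\<^sup>-\<^sup>1\<close> turns the equation into a Volterra equation of the second
  kind, so \<open>f(0) = 0\<close> forces \<open>f = 0\<close>. That \<open>f\<close> is the integral of its pointwise derivative is
  obtained from the Radon-Nikodym theorem applied to the variation of \<open>f\<close>.\<close>

section \<open>Absolutely continuous functions\<close>

definition jump_sum :: "(real \<Rightarrow> complex) \<Rightarrow> real set set \<Rightarrow> real" where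
  "jump_sum f d = (\<Sum>K\<in>d. cmod (f (Sup K) - f (Inf K)))"

lemma division_jump_restrict:
  fixes S :: "real set"
  assumes d: "d division_of S" and xy: "x \<le> y"
  defines "d' \<equiv> {K \<inter> {x..y} |K. K \<in> d \<and> K \<inter> {x..y} \<noteq> {}}"
  shows "d' division_of (S \<inter> {x..y})"
    and "jump_sum f d' = (\<Sum>K\<in>d. if K \<inter> {x..y} = {} then 0
           else cmod (f (Sup (K \<inter> {x..y})) - f (Inf (K \<inter> {x..y}))))"
proof -
  have fin: "finite d" using d by auto
  have "{{x..y}} division_of {x..y}"
    using division_of_self[of x y] xy by (simp add: cbox_interval)
  from division_inter[OF d this]
  have "{k1 \<inter> k2 |k1 k2. k1 \<in> d \<and> k2 \<in> {{x..y}} \<and> k1 \<inter> k2 \<noteq> {}} division_of (S \<inter> {x..y})" .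
  also have "{k1 \<inter> k2 |k1 k2. k1 \<in> d \<and> k2 \<in> {{x..y}} \<and> k1 \<inter> k2 \<noteq> {}} = d'"
    unfolding d'_def by blast
  finally show D': "d' division_of (S \<inter> {x..y})" .
  define e where "e = {K \<in> d. K \<inter> {x..y} \<noteq> {}}"
  have fe: "finite e" using fin by (simp add: e_def)
  have im: "d' = (\<lambda>K. K \<inter> {x..y}) ` e" by (auto simp: d'_def e_def)
  have "jump_sum f d' = (\<Sum>K\<in>e. cmod (f (Sup (K \<inter> {x..y})) - f (Inf (K \<inter> {x..y}))))"
    unfolding jump_sum_def im
  proof (subst sum.reindex_nontrivial[OF fe])
    fix K L assume KL: "K \<in> e" "L \<in> e" "K \<noteq> L" "K \<inter> {x..y} = L \<inter> {x..y}"
    have "interior K \<inter> interior L = {}"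
      using division_ofD(5)[OF d, of K L] KL by (simp add: e_def)
    have int: "interior (K \<inter> {x..y}) = {}"
      proof -
      have "interior (K \<inter> {x..y}) \<subseteq> interior K" "interior (K \<inter> {x..y}) \<subseteq> interior L"
        using KL(4) by (blast intro!: interior_mono)+
      with \<open>interior K \<inter> interior L = {}\<close> show ?thesis by blast
    qed
    obtain u v where uv: "K \<inter> {x..y} = {u..v}" "u \<le> v"
    proof -
      have "K \<inter> {x..y} \<in> d'" using KL im by auto
      then obtain u v where "K \<inter> {x..y} = cbox u v" "K \<inter> {x..y} \<noteq> {}"
        using division_ofD(3,4)[OF D'] by metis
      then show ?thesis using that by (auto simp: cbox_interval)
    qed
    then have "u = v" using int by (simp add: interior_atLeastAtMost_real)
    then show "cmod (f (Sup (K \<inter> {x..y})) - f (Inf (K \<inter> {x..y}))) = 0"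
      using uv by simp
  qed simp
  also have "\<dots> = (\<Sum>K\<in>d. if K \<inter> {x..y} = {} then 0
           else cmod (f (Sup (K \<inter> {x..y})) - f (Inf (K \<inter> {x..y}))))"
    unfolding e_def using fin by (intro sum.mono_neutral_cong_left) auto
  finally show "jump_sum f d' = \<dots>" .
qed

lemma division_jump_split:
  assumes d: "d division_of S" "S \<subseteq> {x..z}" and xyz: "x \<le> y" "y \<le> z"
  obtains d1 S1 d2 S2 where "d1 division_of S1" "S1 \<subseteq> {x..y}" "d2 division_of S2" "S2 \<subseteq> {y..z}"
    "jump_sum f d \<le> jump_sum f d1 + jump_sum f d2"
proof -
  note r1 = division_jump_restrict[OF d(1) xyz(1)] and r2 = division_jump_restrict[OF d(1) xyz(2)]
  have "jump_sum f d \<le> (\<Sum>K\<in>d. (if K \<inter> {x..y} = {} then 0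
           else cmod (f (Sup (K \<inter> {x..y})) - f (Inf (K \<inter> {x..y})))) +
           (if K \<inter> {y..z} = {} then 0
           else cmod (f (Sup (K \<inter> {y..z})) - f (Inf (K \<inter> {y..z})))))"
    unfolding jump_sum_def
  proof (rule sum_mono)
    fix K assume "K \<in> d"
    obtain u v where uv: "K = {u..v}" "u \<le> v" "x \<le> u" "v \<le> z"
    proof -
      have "K \<subseteq> {x..z}" "K \<noteq> {}" "\<exists>u v. K = cbox u v"
        using \<open>K \<in> d\<close> d unfolding division_of_def by blast+
      then show ?thesis using that by (auto simp: cbox_interval)
    qed
    have tri: "cmod (f v - f u) \<le> cmod (f y - f u) + cmod (f v - f y)"
      using norm_triangle_ineq[of "f y - f u" "f v - f y"] by simp
    consider "v \<le> y" | "y \<le> u" | "u < y" "y < v" by linarith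
    then show "cmod (f (Sup K) - f (Inf K)) \<le> (if K \<inter> {x..y} = {} then 0
           else cmod (f (Sup (K \<inter> {x..y})) - f (Inf (K \<inter> {x..y})))) +
           (if K \<inter> {y..z} = {} then 0
           else cmod (f (Sup (K \<inter> {y..z})) - f (Inf (K \<inter> {y..z}))))"
      using uv tri by cases (auto simp: max_def min_def)
  qed
  also have "\<dots> = jump_sum f {K \<inter> {x..y} |K. K \<in> d \<and> K \<inter> {x..y} \<noteq> {}} + jump_sum f {K \<inter> {y..z} |K. K \<in> d \<and> K \<inter> {y..z} \<noteq> {}}"
    unfolding r1(2) r2(2) by (simp add: sum.distrib)
  finally show ?thesis using that[OF r1(1) _ r2(1)] by blast
qed

lemma division_jump_join:
  assumes "d1 division_of S1" "S1 \<subseteq> {x..y}" "d2 division_of S2" "S2 \<subseteq> {y..z}"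
  shows "(d1 \<union> d2) division_of (S1 \<union> S2)" "jump_sum f (d1 \<union> d2) = jump_sum f d1 + jump_sum f d2"
proof -
  have "interior S1 \<inter> interior S2 \<subseteq> interior {y}"
    using assms(2,4) unfolding interior_Int[symmetric]
    by (intro interior_mono) (force dest!: subsetD)
  then have "interior S1 \<inter> interior S2 = {}" by simp
  then show "(d1 \<union> d2) division_of (S1 \<union> S2)"
    using assms by (intro division_disjoint_union) auto
  have "cmod (f (Sup K) - f (Inf K)) = 0" if "K \<in> d1 \<inter> d2" for K
  proof -
    have "K \<noteq> {}" "K \<subseteq> S1" "K \<subseteq> S2" using that assms(1,3) by (auto simp: division_of_def)
    then have "K \<noteq> {}" "K \<subseteq> {y}" using assms(2,4) by (force dest!: subsetD)+
    then have "K = {y}" by blast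
    then show ?thesis by simp
  qed
  then show "jump_sum f (d1 \<union> d2) = jump_sum f d1 + jump_sum f d2"
    unfolding jump_sum_def using assms
    by (subst sum.union_inter_neutral) (auto simp: division_of_def)
qed

definition jump_sums :: "(real \<Rightarrow> complex) \<Rightarrow> real \<Rightarrow> real \<Rightarrow> real set" where
  "jump_sums f x y = {jump_sum f d | d S. d division_of S \<and> S \<subseteq> {x..y}}"

definition variation :: "(real \<Rightarrow> complex) \<Rightarrow> real \<Rightarrow> real \<Rightarrow> real" where
  "variation f x y = Sup (jump_sums f x y)"

lemma zero_in_jump_sums: "0 \<in> jump_sums f x y"
proof -
  have "{} division_of ({}::real set)" by simp
  moreover have "jump_sum f {} = 0" by (simp add: jump_sum_def)
  ultimately show ?thesis unfolding jump_sums_def by (metis (mono_tags, lifting) empty_subsetI mem_Collect_eq)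
qed

lemma jump_sums_mono: "x' \<le> x \<Longrightarrow> y \<le> y' \<Longrightarrow> jump_sums f x y \<subseteq> jump_sums f x' y'"
proof
  fix s assume xy: "x' \<le> x" "y \<le> y'" and "s \<in> jump_sums f x y"
  then obtain d S where d: "d division_of S" "S \<subseteq> {x..y}" "s = jump_sum f d"
    by (auto simp: jump_sums_def)
  have "{x..y} \<subseteq> {x'..y'}" using xy by simp
  with d have "S \<subseteq> {x'..y'}" by (rule_tac subset_trans)
  with d show "s \<in> jump_sums f x' y'" unfolding jump_sums_def by blast
qed

lemma division_length_le:
  fixes x y :: real
  assumes "d division_of S" "S \<subseteq> {x..y}" "x \<le> y"
  shows "(\<Sum>K\<in>d. Sup K - Inf K) \<le> y - x"
proof -
  have "(\<Sum>K\<in>d. Sup K - Inf K) = sum (measure lborel) d"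
  proof (rule sum.cong)
    fix K assume "K \<in> d"
    then obtain u v where "K = cbox u v" "K \<noteq> {}"
      using division_ofD(3,4)[OF assms(1)] by metis
    then show "Sup K - Inf K = measure lborel K" by (auto simp: cbox_interval)
  qed simp
  also have "\<dots> \<le> measure lborel (cbox x y)"
    using assms by (intro subadditive_content_division) (auto simp: cbox_interval)
  finally show ?thesis using assms by simp
qed

lemma AC_local_jump_sums_bound:
  assumes "absolutely_continuous_fun_on a b f" "0 < \<epsilon>"
  obtains \<delta> where "0 < \<delta>" "\<And>x y s. a \<le> x \<Longrightarrow> x \<le> y \<Longrightarrow> y \<le> b \<Longrightarrow> y - x < \<delta> \<Longrightarrow> s \<in> jump_sums f x y \<Longrightarrow> s < \<epsilon>"
proof -
  obtain \<delta> where \<delta>: "\<delta> > 0" "\<And>d S. d division_of S \<Longrightarrow> S \<subseteq> {a..b} \<Longrightarrow> (\<Sum>K\<in>d. Sup K - Inf K) < \<delta> \<Longrightarrow>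
      (\<Sum>K\<in>d. cmod (f (Sup K) - f (Inf K))) < \<epsilon>"
    using assms unfolding absolutely_continuous_fun_on_def by meson
  show ?thesis
  proof (rule that[OF \<delta>(1)])
    fix x y s assume xy: "a \<le> x" "x \<le> y" "y \<le> b" "y - x < \<delta>" "s \<in> jump_sums f x y"
    then obtain d S where d: "d division_of S" "S \<subseteq> {x..y}" "s = jump_sum f d"
      by (auto simp: jump_sums_def)
    have "(\<Sum>K\<in>d. Sup K - Inf K) < \<delta>"
      using division_length_le[OF d(1,2) xy(2)] xy by linarith
    moreover have "S \<subseteq> {a..b}" using d(2) xy by force
    ultimately show "s < \<epsilon>" using \<delta>(2)[OF d(1)] d(3) by (simp add: jump_sum_def)
  qed
qed

lemma jump_sums_bdd_above:
  assumes "absolutely_continuous_fun_on a b f" "a \<le> b"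
  shows "bdd_above (jump_sums f a b)"
proof -
  obtain \<delta> where \<delta>: "0 < \<delta>" "\<And>x y s. a \<le> x \<Longrightarrow> x \<le> y \<Longrightarrow> y \<le> b \<Longrightarrow> y - x < \<delta> \<Longrightarrow> s \<in> jump_sums f x y \<Longrightarrow> s < 1"
    using AC_local_jump_sums_bound[OF assms(1), of 1] by auto
  have *: "s \<le> real k + 1" if "a \<le> y" "y \<le> b" "y \<le> a + real k * (\<delta> / 2)" "s \<in> jump_sums f a y" for k y s
    using that
  proof (induction k arbitrary: y s)
    case 0
    then show ?case using \<delta>(2)[of a y s] \<delta>(1) by auto
  next
    case (Suc k)
    show ?case
    proof (cases "y \<le> a + real k * (\<delta> / 2)")
      case True
      then show ?thesis using Suc.IH[of y s] Suc.prems by simp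
    next
      case False
      define m where "m = a + real k * (\<delta> / 2)"
      have m: "a \<le> m" "m \<le> y" using False \<delta>(1) by (auto simp: m_def)
      obtain d S where d: "d division_of S" "S \<subseteq> {a..y}" "s = jump_sum f d"
        using Suc.prems by (auto simp: jump_sums_def)
      obtain d1 S1 d2 S2 where s: "d1 division_of S1" "S1 \<subseteq> {a..m}" "d2 division_of S2" "S2 \<subseteq> {m..y}"
        "jump_sum f d \<le> jump_sum f d1 + jump_sum f d2"
        using division_jump_split[OF d(1,2) m] by metis
      have "jump_sum f d1 \<le> real k + 1"
        using Suc.IH[of m "jump_sum f d1"] s m Suc.prems(2) by (auto simp: jump_sums_def m_def)
      moreover have "jump_sum f d2 < 1"
      proof (rule \<delta>(2)[of m y])
        have "y - m \<le> \<delta> / 2" using Suc.prems(3) by (simp add: m_def field_simps)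
        then show "y - m < \<delta>" using \<delta>(1) by simp
      qed (use s m Suc.prems in \<open>auto simp: jump_sums_def\<close>)
      ultimately show ?thesis using s(5) d(3) by simp
    qed
  qed
  obtain k where "b - a < real k * (\<delta> / 2)"
    using reals_Archimedean3[of "\<delta>/2"] \<delta>(1) half_gt_zero by blast
  then show ?thesis using *[of b k] assms(2) by (intro bdd_aboveI[of _ "real k + 1"]) auto
qed

context
  fixes f :: "real \<Rightarrow> complex" and a b :: real
  assumes AC: "absolutely_continuous_fun_on a b f" and ab: "a \<le> b"
begin

lemma jump_sums_bdd_above': "a \<le> x \<Longrightarrow> y \<le> b \<Longrightarrow> bdd_above (jump_sums f x y)"
  using jump_sums_bdd_above[OF AC ab] jump_sums_mono[of a x y b f] by (rule bdd_above_mono)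

lemma variation_upper: "a \<le> x \<Longrightarrow> y \<le> b \<Longrightarrow> s \<in> jump_sums f x y \<Longrightarrow> s \<le> variation f x y"
  unfolding variation_def by (intro cSup_upper jump_sums_bdd_above')

lemma variation_nonneg: "a \<le> x \<Longrightarrow> y \<le> b \<Longrightarrow> 0 \<le> variation f x y"
  by (intro variation_upper zero_in_jump_sums)

lemma norm_diff_le_variation:
  assumes "a \<le> x" "x \<le> y" "y \<le> b"
  shows "cmod (f y - f x) \<le> variation f x y"
proof -
  have "{{x..y}} division_of {x..y}"
    using division_of_self[of x y] assms by (simp add: cbox_interval)
  then have "jump_sum f {{x..y}} \<in> jump_sums f x y"
    unfolding jump_sums_def by blast
  then show ?thesis using variation_upper[OF assms(1,3)] assms by (simp add: jump_sum_def)
qed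

lemma variation_additive:
  assumes "a \<le> x" "x \<le> y" "y \<le> z" "z \<le> b"
  shows "variation f x z = variation f x y + variation f y z"
proof (rule antisym)
  have ne: "jump_sums f u v \<noteq> {}" for u v using zero_in_jump_sums by blast
  show "variation f x z \<le> variation f x y + variation f y z"
    unfolding variation_def[of f x z]
  proof (rule cSup_least[OF ne])
    fix s assume "s \<in> jump_sums f x z"
    then obtain d S where d: "d division_of S" "S \<subseteq> {x..z}" "s = jump_sum f d"
      by (auto simp: jump_sums_def)
    obtain d1 S1 d2 S2 where s: "d1 division_of S1" "S1 \<subseteq> {x..y}" "d2 division_of S2" "S2 \<subseteq> {y..z}"
      "jump_sum f d \<le> jump_sum f d1 + jump_sum f d2"
      using division_jump_split[OF d(1,2) assms(2,3)] by metis
    have "jump_sum f d1 \<le> variation f x y" "jump_sum f d2 \<le> variation f y z"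
      using s assms by (auto intro!: variation_upper simp: jump_sums_def)
    with s d show "s \<le> variation f x y + variation f y z" by linarith
  qed
  have *: "s1 + s2 \<le> variation f x z" if "s1 \<in> jump_sums f x y" "s2 \<in> jump_sums f y z" for s1 s2
  proof -
    obtain d1 S1 where s1: "d1 division_of S1" "S1 \<subseteq> {x..y}" "s1 = jump_sum f d1"
      using \<open>s1 \<in> jump_sums f x y\<close> unfolding jump_sums_def by blast
    obtain d2 S2 where s2: "d2 division_of S2" "S2 \<subseteq> {y..z}" "s2 = jump_sum f d2"
      using \<open>s2 \<in> jump_sums f y z\<close> unfolding jump_sums_def by blast
    note s = s1 s2
    have "S1 \<union> S2 \<subseteq> {x..z}" using s assms by force
    then have "jump_sum f (d1 \<union> d2) \<in> jump_sums f x z"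
      using division_jump_join(1)[OF s(1,2,4,5)] unfolding jump_sums_def by blast
    then show ?thesis using variation_upper[of x z] assms division_jump_join(2)[OF s(1,2,4,5)] s by metis
  qed
  have "variation f x y \<le> variation f x z - s2" if "s2 \<in> jump_sums f y z" for s2
    unfolding variation_def[of f x y] using *[OF _ that] by (intro cSup_least[OF ne]) (auto simp: le_diff_eq)
  then have "variation f y z \<le> variation f x z - variation f x y"
    unfolding variation_def[of f y z] by (intro cSup_least[OF ne]) (force simp: le_diff_eq)
  then show "variation f x y + variation f y z \<le> variation f x z" by simp
qed

lemma AC_variation: "absolutely_continuous_fun_on a b (\<lambda>t. complex_of_real (variation f a t))"
  unfolding absolutely_continuous_fun_on_def
proof (intro allI impI)
  fix \<epsilon> :: real assume \<epsilon>: "\<epsilon> > 0"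
  obtain \<delta> where \<delta>: "\<delta> > 0" "\<And>d S. d division_of S \<Longrightarrow> S \<subseteq> {a..b} \<Longrightarrow> (\<Sum>K\<in>d. Sup K - Inf K) < \<delta> \<Longrightarrow>
      (\<Sum>K\<in>d. cmod (f (Sup K) - f (Inf K))) < \<epsilon> / 2"
    using AC \<epsilon> unfolding absolutely_continuous_fun_on_def by (meson half_gt_zero)
  have "(\<Sum>K\<in>d. cmod (complex_of_real (variation f a (Sup K)) - complex_of_real (variation f a (Inf K)))) < \<epsilon>"
    if d: "d division_of S" "S \<subseteq> {a..b}" "(\<Sum>K\<in>d. Sup K - Inf K) < \<delta>" for d S
  proof -
    have fin: "finite d" using d by auto
    define \<eta> where "\<eta> = \<epsilon> / (4 * (card d + 1))"
    have \<eta>: "\<eta> > 0" using \<epsilon> by (simp add: \<eta>_def)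
    have K: "K = {Inf K..Sup K} \<and> a \<le> Inf K \<and> Inf K \<le> Sup K \<and> Sup K \<le> b" if Kd: "K \<in> d" for K
    proof -
      obtain u v where "K = cbox u v" "K \<noteq> {}" "K \<subseteq> S"
        using division_ofD(2,3,4)[OF d(1) Kd] by metis
      moreover from this have "K \<subseteq> {a..b}" using d(2) by blast
      ultimately show ?thesis by (auto simp: cbox_interval)
    qed
    have "\<exists>e. \<exists>S. e division_of S \<and> S \<subseteq> K \<and> variation f (Inf K) (Sup K) - \<eta> < jump_sum f e \<and> (\<forall>J\<in>e. interior J \<noteq> {})"
      if Kd: "K \<in> d" for K
    proof -
      have "jump_sums f (Inf K) (Sup K) \<noteq> {}" using zero_in_jump_sums by blast
      moreover have "variation f (Inf K) (Sup K) - \<eta> < Sup (jump_sums f (Inf K) (Sup K))"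
        using \<eta> by (simp add: variation_def)
      ultimately obtain s where "s \<in> jump_sums f (Inf K) (Sup K)" "variation f (Inf K) (Sup K) - \<eta> < s"
        using less_cSupD by blast
      then obtain e S where e: "e division_of S" "S \<subseteq> {Inf K..Sup K}" "variation f (Inf K) (Sup K) - \<eta> < jump_sum f e"
        by (auto simp: jump_sums_def)
      define e' where "e' = {J \<in> e. interior J \<noteq> {}}"
      have "e' division_of \<Union>e'" using division_of_subset[OF division_of_union_self[OF e(1)], of e'] by (simp add: e'_def)
      moreover have "\<Union>e' \<subseteq> K" using e K[OF Kd] division_ofD(2)[OF e(1)] unfolding e'_def by blast
      moreover have "jump_sum f e' = jump_sum f e"
        unfolding jump_sum_def
      proof (rule sum.mono_neutral_left)
        show "\<forall>i\<in>e - e'. cmod (f (Sup i) - f (Inf i)) = 0"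
        proof
          fix J assume J: "J \<in> e - e'"
          then obtain u v where "J = cbox u v" "J \<noteq> {}"
            using division_ofD(3,4)[OF e(1)] by (metis DiffD1)
          moreover have "interior J = {}" using J by (simp add: e'_def)
          ultimately have "u = v" by (auto simp: cbox_interval interior_atLeastAtMost_real)
          then show "cmod (f (Sup J) - f (Inf J)) = 0" using \<open>J = cbox u v\<close> by simp
        qed
      qed (use e in \<open>auto simp: e'_def\<close>)
      ultimately show ?thesis using e(3) by (intro exI[of _ e'] exI[of _ "\<Union>e'"]) (auto simp: e'_def)
    qed
    then obtain e where e: "\<And>K. K \<in> d \<Longrightarrow> \<exists>S. e K division_of S \<and> S \<subseteq> K \<and> variation f (Inf K) (Sup K) - \<eta> < jump_sum f (e K) \<and> (\<forall>J\<in>e K. interior J \<noteq> {})"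
      by metis
    then obtain R where R: "\<And>K. K \<in> d \<Longrightarrow> e K division_of R K \<and> R K \<subseteq> K \<and> variation f (Inf K) (Sup K) - \<eta> < jump_sum f (e K) \<and> (\<forall>J\<in>e K. interior J \<noteq> {})"
      by metis
    have sub: "J \<subseteq> K" if "K \<in> d" "J \<in> e K" for J K
      using R[OF that(1)] that(2) division_ofD(2)[of "e K" "R K" J] by auto
    have dis: "e K \<inter> e L = {}" if "K \<in> d" "L \<in> d" "K \<noteq> L" for K L
    proof (rule ccontr)
      assume "e K \<inter> e L \<noteq> {}"
      then obtain J where J: "J \<in> e K" "J \<in> e L" by blast
      have "interior J \<subseteq> interior K \<inter> interior L"
        using sub[OF that(1) J(1)] sub[OF that(2) J(2)] by (simp add: interior_mono)
      then have "interior J = {}" using division_ofD(5)[OF d(1) that] by simp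
      then show False using R[OF that(1)] J(1) by simp
    qed
    have fe: "finite (e K)" if "K \<in> d" for K using R[OF that] by auto
    have U: "(\<Union>K\<in>d. e K) division_of (\<Union>K\<in>d. R K)"
    proof (rule division_ofI)
      show "finite (\<Union>K\<in>d. e K)" using fin fe by blast
      have "\<Union>(e K) = R K" if "K \<in> d" for K using R[OF that] division_ofD(6)[of "e K" "R K"] by simp
      then show "\<Union>(\<Union>K\<in>d. e K) = (\<Union>K\<in>d. R K)" unfolding set_eq_iff by blast
      fix J assume "J \<in> (\<Union>K\<in>d. e K)"
      then obtain K where K: "K \<in> d" "J \<in> e K" by blast
      have eK: "e K division_of R K" using R[OF K(1)] by simp
      show "J \<subseteq> (\<Union>K\<in>d. R K)" using division_ofD(2)[OF eK K(2)] K(1) by blast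
      show "J \<noteq> {}" "\<exists>u v. J = cbox u v" using division_ofD(3,4)[OF eK K(2)] by simp_all
      fix J' assume "J' \<in> (\<Union>K\<in>d. e K)" and ne: "J \<noteq> J'"
      then obtain L where L: "L \<in> d" "J' \<in> e L" by blast
      show "interior J \<inter> interior J' = {}"
      proof (cases "K = L")
        case True
        then show ?thesis using division_ofD(5)[OF eK K(2), of J'] L ne by simp
      next
        case False
        then show ?thesis
          using division_ofD(5)[OF d(1) K(1) L(1)] interior_mono[OF sub[OF K]] interior_mono[OF sub[OF L]] by blast
      qed
    qed
    have "(\<Sum>J\<in>(\<Union>K\<in>d. e K). Sup J - Inf J) = (\<Sum>K\<in>d. \<Sum>J\<in>e K. Sup J - Inf J)"
      using fin fe dis by (intro sum.UNION_disjoint) auto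
    also have "\<dots> \<le> (\<Sum>K\<in>d. Sup K - Inf K)"
    proof (rule sum_mono)
      fix L assume L: "L \<in> d"
      show "(\<Sum>J\<in>e L. Sup J - Inf J) \<le> Sup L - Inf L"
        using R[OF L] K[OF L] by (intro division_length_le[of _ "R L"]) auto
    qed
    finally have "(\<Sum>J\<in>(\<Union>K\<in>d. e K). Sup J - Inf J) < \<delta>" using d(3) by linarith
    moreover have "(\<Union>K\<in>d. R K) \<subseteq> {a..b}"
    proof (rule UN_least)
      fix L assume L: "L \<in> d"
      have "R L \<subseteq> L" using R[OF L] by simp
      also have "L \<subseteq> {a..b}" using division_ofD(2)[OF d(1) L] d(2) by simp
      finally show "R L \<subseteq> {a..b}" .
    qed
    ultimately have small: "jump_sum f (\<Union>K\<in>d. e K) < \<epsilon> / 2"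
      using \<delta>(2)[OF U] by (simp add: jump_sum_def)
    have "(\<Sum>K\<in>d. cmod (complex_of_real (variation f a (Sup K)) - complex_of_real (variation f a (Inf K))))
        = (\<Sum>K\<in>d. variation f (Inf K) (Sup K))"
    proof (rule sum.cong)
      fix L assume L: "L \<in> d"
      have "variation f a (Sup L) - variation f a (Inf L) = variation f (Inf L) (Sup L)"
        using variation_additive[of a "Inf L" "Sup L"] K[OF L] by simp
      then show "cmod (complex_of_real (variation f a (Sup L)) - complex_of_real (variation f a (Inf L))) = variation f (Inf L) (Sup L)"
        using variation_nonneg[of "Inf L" "Sup L"] K[OF L] by (simp flip: of_real_diff)
    qed simp
    also have "\<dots> \<le> (\<Sum>K\<in>d. jump_sum f (e K) + \<eta>)"
    proof (rule sum_mono)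
      fix L assume "L \<in> d"
      from R[OF this] show "variation f (Inf L) (Sup L) \<le> jump_sum f (e L) + \<eta>" by linarith
    qed
    also have "\<dots> = jump_sum f (\<Union>K\<in>d. e K) + card d * \<eta>"
      unfolding jump_sum_def sum.distrib using fin fe dis by (subst sum.UNION_disjoint) auto
    also have "card d * \<eta> \<le> \<epsilon> / 4"
      using \<epsilon> by (simp add: \<eta>_def field_simps)
    finally show ?thesis using small \<epsilon> by simp
  qed
  then show "\<exists>\<delta>>0. \<forall>d S. d division_of S \<and> S \<subseteq> {a..b} \<and> (\<Sum>K\<in>d. Sup K - Inf K) < \<delta> \<longrightarrow>
      (\<Sum>K\<in>d. cmod (complex_of_real (variation f a (Sup K)) - complex_of_real (variation f a (Inf K)))) < \<epsilon>"
    using \<delta>(1) by blast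
qed

end

lemma AC_dominated:
  assumes "absolutely_continuous_fun_on a b f" "absolutely_continuous_fun_on a b g"
    and le: "\<And>x y. a \<le> x \<Longrightarrow> x \<le> y \<Longrightarrow> y \<le> b \<Longrightarrow> cmod (h y - h x) \<le> cmod (f y - f x) + cmod (g y - g x)"
  shows "absolutely_continuous_fun_on a b h"
  unfolding absolutely_continuous_fun_on_def
proof (intro allI impI)
  fix \<epsilon> :: real assume "\<epsilon> > 0"
  then obtain \<delta>1 where 1: "\<delta>1 > 0" "\<And>d S. d division_of S \<Longrightarrow> S \<subseteq> {a..b} \<Longrightarrow> (\<Sum>K\<in>d. Sup K - Inf K) < \<delta>1 \<Longrightarrow>
      (\<Sum>K\<in>d. cmod (f (Sup K) - f (Inf K))) < \<epsilon> / 2"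
    using assms(1) unfolding absolutely_continuous_fun_on_def by (meson half_gt_zero)
  obtain \<delta>2 where 2: "\<delta>2 > 0" "\<And>d S. d division_of S \<Longrightarrow> S \<subseteq> {a..b} \<Longrightarrow> (\<Sum>K\<in>d. Sup K - Inf K) < \<delta>2 \<Longrightarrow>
      (\<Sum>K\<in>d. cmod (g (Sup K) - g (Inf K))) < \<epsilon> / 2"
    using assms(2) \<open>\<epsilon> > 0\<close> unfolding absolutely_continuous_fun_on_def by (meson half_gt_zero)
  have "(\<Sum>K\<in>d. cmod (h (Sup K) - h (Inf K))) < \<epsilon>"
    if d: "d division_of S" "S \<subseteq> {a..b}" "(\<Sum>K\<in>d. Sup K - Inf K) < min \<delta>1 \<delta>2" for d S
  proof -
    have "(\<Sum>K\<in>d. cmod (h (Sup K) - h (Inf K))) \<le>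
        (\<Sum>K\<in>d. cmod (f (Sup K) - f (Inf K)) + cmod (g (Sup K) - g (Inf K)))"
    proof (rule sum_mono)
      fix K assume K: "K \<in> d"
      obtain u v where "K = cbox u v" "K \<noteq> {}" "K \<subseteq> S"
        using division_ofD(2,3,4)[OF d(1) K] by metis
      moreover from this have "K \<subseteq> {a..b}" using d(2) by blast
      ultimately show "cmod (h (Sup K) - h (Inf K)) \<le> cmod (f (Sup K) - f (Inf K)) + cmod (g (Sup K) - g (Inf K))"
        using le[of u v] by (auto simp: cbox_interval)
    qed
    also have "\<dots> < \<epsilon>" using 1(2)[OF d(1,2)] 2(2)[OF d(1,2)] d(3) by (simp add: sum.distrib)
    finally show ?thesis .
  qed
  then show "\<exists>\<delta>>0. \<forall>d S. d division_of S \<and> S \<subseteq> {a..b} \<and> (\<Sum>K\<in>d. Sup K - Inf K) < \<delta> \<longrightarrow>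
      (\<Sum>K\<in>d. cmod (h (Sup K) - h (Inf K))) < \<epsilon>"
    using 1(1) 2(1) by (intro exI[of _ "min \<delta>1 \<delta>2"]) auto
qed

lemma AC_imp_continuous_on:
  assumes "absolutely_continuous_fun_on a b f"
  shows "continuous_on {a..b} f"
  unfolding continuous_on_iff
proof (intro ballI allI impI)
  fix x e :: real assume x: "x \<in> {a..b}" and e: "0 < e"
  obtain \<delta> where \<delta>: "\<delta> > 0" "\<And>d S. d division_of S \<Longrightarrow> S \<subseteq> {a..b} \<Longrightarrow> (\<Sum>K\<in>d. Sup K - Inf K) < \<delta> \<Longrightarrow>
      (\<Sum>K\<in>d. cmod (f (Sup K) - f (Inf K))) < e"
    using assms e unfolding absolutely_continuous_fun_on_def by meson
  have "dist (f u) (f v) < e" if "u \<in> {a..b}" "v \<in> {a..b}" "u \<le> v" "v - u < \<delta>" for u v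
  proof -
    have "{{u..v}} division_of {u..v}"
      using division_of_self[of u v] that by (simp add: cbox_interval)
    from \<delta>(2)[OF this] show ?thesis using that by (simp add: dist_norm norm_minus_commute)
  qed
  from this[of x] this[of _ x] show "\<exists>d>0. \<forall>x'\<in>{a..b}. dist x' x < d \<longrightarrow> dist (f x') (f x) < e"
    using \<delta>(1) x by (intro exI[of _ \<delta>]) (smt (verit) dist_commute dist_real_def)
qed

lemma finite_cover_le_imp_null:
  fixes \<nu> :: "real measure"
  assumes \<nu>: "sets \<nu> = sets borel" and ab: "a < b" and N: "N \<in> sets borel" "emeasure lborel N = 0" "N \<subseteq> {a..b}"
    and small: "\<And>\<epsilon>. \<epsilon> > 0 \<Longrightarrow> \<exists>\<delta>>0. \<forall>d S. d division_of S \<and> S \<subseteq> {a..b} \<and> (\<Sum>K\<in>d. Sup K - Inf K) < \<delta> \<longrightarrow>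
      (\<Sum>K\<in>d. emeasure \<nu> K) \<le> ennreal \<epsilon>"
  shows "emeasure \<nu> N = 0"
proof -
  have "emeasure \<nu> N \<le> ennreal \<epsilon>" if \<epsilon>: "\<epsilon> > 0" for \<epsilon> :: real
  proof -
    obtain \<delta> where \<delta>: "\<delta> > 0" "\<And>d S. d division_of S \<Longrightarrow> S \<subseteq> {a..b} \<Longrightarrow> (\<Sum>K\<in>d. Sup K - Inf K) < \<delta> \<Longrightarrow>
      (\<Sum>K\<in>d. emeasure \<nu> K) \<le> ennreal \<epsilon>"
      using small[OF \<epsilon>] by blast
    have "N \<in> sets lebesgue" using N(1) by simp
    then obtain U where U: "open U" "N \<subseteq> U" "emeasure lebesgue (U - N) < ennreal \<delta>"
      using sets_lebesgue_outer_open[OF _ \<delta>(1)] by metis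
    have UN: "U \<in> sets borel" using U(1) by simp
    have "emeasure lborel U \<le> emeasure lborel N + emeasure lborel (U - N)"
      using U(2) UN N(1) by (subst plus_emeasure) (auto intro!: emeasure_mono)
    also have "\<dots> < ennreal \<delta>" using N(2) U(3) UN N(1) by simp
    finally have lU: "emeasure lborel U < ennreal \<delta>" .
    have "gauge (\<lambda>x. if x \<in> U then U else UNIV)" using U(1) by (auto simp: gauge_def)
    note gauge = this
    have Nab: "N \<subseteq> cbox a b" "box a b \<noteq> {}" using ab N(3) by (simp_all add: cbox_interval box_real)
    obtain \<D> where D: "countable \<D>" "\<Union>\<D> \<subseteq> cbox a b" "\<And>K. K \<in> \<D> \<Longrightarrow> interior K \<noteq> {} \<and> (\<exists>c d. K = cbox c d)"
      "pairwise (\<lambda>A B. interior A \<inter> interior B = {}) \<D>"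
      "\<And>K. K \<in> \<D> \<Longrightarrow> \<exists>x\<in>N \<inter> K. K \<subseteq> (if x \<in> U then U else UNIV)" "N \<subseteq> \<Union>\<D>"
      by (rule covering_lemma[OF Nab gauge]) (rule that)
    have DU: "K \<subseteq> U" if "K \<in> \<D>" for K
      using D(5)[OF that] U(2) by (auto split: if_splits)
    have Kb: "K \<in> sets borel" if "K \<in> \<D>" for K using D(3)[OF that] by auto
    have fin: "emeasure \<nu> (\<Union>F) \<le> ennreal \<epsilon>" if F: "finite F" "F \<subseteq> \<D>" for F
    proof -
      have div: "F division_of \<Union>F"
      proof (rule division_ofI)
        fix K L assume "K \<in> F" "L \<in> F" "K \<noteq> L"
        then show "interior K \<inter> interior L = {}" using D(4) F by (auto simp: pairwise_def)
      next
        fix K assume "K \<in> F"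
        then show "K \<noteq> {}" using D(3) F by (metis interior_empty subsetD)
      qed (use F D(3) in \<open>auto dest!: subsetD\<close>)
      have "ennreal (\<Sum>K\<in>F. Sup K - Inf K) = ennreal (\<Sum>K\<in>F. measure lebesgue K)"
      proof (intro arg_cong[of _ _ ennreal] sum.cong refl)
        fix K assume "K \<in> F"
        then obtain u v where "K = cbox u v" "K \<noteq> {}"
          using D(3) F by (metis interior_empty subsetD)
        then show "Sup K - Inf K = measure lebesgue K" by (auto simp: cbox_interval)
      qed
      also have "\<dots> = ennreal (measure lebesgue (\<Union>F))"
        using content_division[OF div] by simp
      also have "\<dots> = emeasure lebesgue (\<Union>F)"
        using lmeasurable_division[OF div] by (simp add: emeasure_eq_measure2 fmeasurableD2)
      also have "\<dots> \<le> emeasure lebesgue U"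
        using DU F UN by (intro emeasure_mono) (auto dest!: subsetD)
      also have "\<dots> < ennreal \<delta>" using lU UN by simp
      finally have "(\<Sum>K\<in>F. Sup K - Inf K) < \<delta>"
        by (metis \<delta>(1) ennreal_less_iff ennreal_neg linorder_not_le not_less_iff_gr_or_eq order_less_le_trans zero_less_iff_neq_zero)
      moreover have "\<Union>F \<subseteq> {a..b}" using D(2) Union_mono[OF F(2)] by (simp add: cbox_interval)
      ultimately have "(\<Sum>K\<in>F. emeasure \<nu> K) \<le> ennreal \<epsilon>" using \<delta>(2)[OF div] by blast
      moreover have "emeasure \<nu> (\<Union>F) \<le> (\<Sum>K\<in>F. emeasure \<nu> K)"
        using emeasure_subadditive_finite[of F "\<lambda>K. K" \<nu>] F Kb \<nu> by auto
      ultimately show ?thesis by (rule order_trans[rotated])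
    qed
    show ?thesis
    proof (cases "\<D> = {}")
      case True
      then show ?thesis using D(6) by simp
    next
      case False
      define E where "E n = \<Union>(from_nat_into \<D> ` {..<n})" for n
      have Eb: "E n \<in> sets \<nu>" for n
        unfolding E_def \<nu> using Kb from_nat_into[OF False] by auto
      have R: "range (from_nat_into \<D>) = \<D>" by (rule range_from_nat_into[OF False D(1)])
      have "\<Union>\<D> = (\<Union>n. E n)"
      proof (intro equalityI subsetI)
        fix x assume "x \<in> \<Union>\<D>"
        then obtain n where "x \<in> from_nat_into \<D> n" using R by (metis UnionE rangeE)
        then have "x \<in> E (Suc n)" by (auto simp: E_def)
        then show "x \<in> (\<Union>n. E n)" by blast
      next
        fix x assume "x \<in> (\<Union>n. E n)"
        then show "x \<in> \<Union>\<D>" using from_nat_into[OF False] by (auto simp: E_def)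
      qed
      then have "emeasure \<nu> (\<Union>\<D>) = (SUP n. emeasure \<nu> (E n))"
        using Eb by (subst SUP_emeasure_incseq) (auto simp: incseq_def E_def intro!: Union_mono image_mono)
      also have "\<dots> \<le> ennreal \<epsilon>"
        unfolding E_def using from_nat_into[OF False] by (intro SUP_least fin) auto
      finally have "emeasure \<nu> (\<Union>\<D>) \<le> ennreal \<epsilon>" .
      moreover have "\<Union>\<D> \<in> sets \<nu>" using Kb D(1) \<nu> by auto
      ultimately show ?thesis using emeasure_mono[OF D(6)] order_trans by blast
    qed
  qed
  then show ?thesis
    by (metis ennreal_0 ennreal_le_epsilon le_zero_eq add_0 zero_le)
qed

lemma AC_mono_density:
  fixes G :: "real \<Rightarrow> real"
  assumes mono: "\<And>x y. a \<le> x \<Longrightarrow> x \<le> y \<Longrightarrow> y \<le> b \<Longrightarrow> G x \<le> G y"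
    and AC: "absolutely_continuous_fun_on a b (\<lambda>x. complex_of_real (G x))" and ab: "a < b"
  obtains g where "integrable lborel g" "\<And>t. a \<le> t \<Longrightarrow> t \<le> b \<Longrightarrow> G t - G a = (LBINT s:{a..t}. g s)"
proof -
  define M where "M t = G (min b (max a t))" for t
  have Mm: "M x \<le> M y" if "x \<le> y" for x y
    unfolding M_def using that ab by (intro mono) auto
  have "continuous_on {a..b} (\<lambda>x. Re (complex_of_real (G x)))"
    by (rule continuous_on_Re[OF AC_imp_continuous_on[OF AC]])
  then have "continuous_on {a..b} G" by simp
  then have Mc: "continuous_on UNIV M"
    unfolding M_def
    by (rule continuous_on_compose2) (use ab in \<open>auto intro!: continuous_intros\<close>)
  define \<nu> where "\<nu> = interval_measure M"
  have \<nu>s[simp, measurable_cong]: "sets \<nu> = sets borel" by (simp add: \<nu>_def)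
  have \<nu>Icc: "emeasure \<nu> {x..y} = ennreal (M y - M x)" if "x \<le> y" for x y
    unfolding \<nu>_def by (rule emeasure_interval_measure_Icc[OF that Mm Mc])
  have M_AC: "\<exists>\<delta>>0. \<forall>d S. d division_of S \<and> S \<subseteq> {a..b} \<and> (\<Sum>K\<in>d. Sup K - Inf K) < \<delta> \<longrightarrow>
      (\<Sum>K\<in>d. emeasure \<nu> K) \<le> ennreal \<epsilon>" if \<epsilon>: "\<epsilon> > 0" for \<epsilon>
  proof -
    obtain \<delta> where \<delta>: "\<delta> > 0" "\<And>d S. d division_of S \<Longrightarrow> S \<subseteq> {a..b} \<Longrightarrow> (\<Sum>K\<in>d. Sup K - Inf K) < \<delta> \<Longrightarrow>
      (\<Sum>K\<in>d. cmod (complex_of_real (G (Sup K)) - complex_of_real (G (Inf K)))) < \<epsilon>"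
      using AC \<epsilon> unfolding absolutely_continuous_fun_on_def by meson
    have "(\<Sum>K\<in>d. emeasure \<nu> K) \<le> ennreal \<epsilon>"
      if d: "d division_of S" "S \<subseteq> {a..b}" "(\<Sum>K\<in>d. Sup K - Inf K) < \<delta>" for d S
    proof -
      have "(\<Sum>K\<in>d. emeasure \<nu> K) = (\<Sum>K\<in>d. ennreal (cmod (complex_of_real (G (Sup K)) - complex_of_real (G (Inf K)))))"
      proof (rule sum.cong)
        fix K assume K: "K \<in> d"
        obtain u v where uv: "K = cbox u v" "K \<noteq> {}" "K \<subseteq> S"
          using division_ofD(2,3,4)[OF d(1) K] by metis
        moreover from this have "K \<subseteq> {a..b}" using d(2) by blast
        ultimately have "u \<le> v" "a \<le> u" "v \<le> b" by (auto simp: cbox_interval)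
        then show "emeasure \<nu> K = ennreal (cmod (complex_of_real (G (Sup K)) - complex_of_real (G (Inf K))))"
          using \<nu>Icc[of u v] mono[of u v] uv by (simp add: cbox_interval M_def flip: of_real_diff)
      qed simp
      also have "\<dots> \<le> ennreal \<epsilon>"
        using \<delta>(2)[OF d] by (subst sum_ennreal) (auto intro!: ennreal_leI)
      finally show ?thesis .
    qed
    then show ?thesis using \<delta>(1) by blast
  qed
  have out1: "emeasure \<nu> {b..b + real n} = 0" for n
    using ab by (subst \<nu>Icc) (auto simp: M_def)
  have out2: "emeasure \<nu> {a - real n..a} = 0" for n
    using ab by (subst \<nu>Icc) (auto simp: M_def)
  have cover: "UNIV = {a..b} \<union> ((\<Union>n. {b..b + real n}) \<union> (\<Union>n. {a - real n..a}))"
  proof -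
    have "x \<in> {a..b} \<union> ((\<Union>n. {b..b + real n}) \<union> (\<Union>n. {a - real n..a}))" for x
    proof -
      obtain n where "\<bar>x\<bar> + \<bar>a\<bar> + \<bar>b\<bar> \<le> real n" using real_arch_simple by blast
      then show ?thesis by (cases "a \<le> x"; cases "x \<le> b") (auto intro!: exI[of _ n])
    qed
    then show ?thesis by blast
  qed
  have out: "((\<Union>n. {b..b + real n}) \<union> (\<Union>n. {a - real n..a})) \<in> null_sets \<nu>"
    using out1 out2 by (intro null_sets.Un null_sets_UN) auto
  have ac: "absolutely_continuous lborel \<nu>"
    unfolding absolutely_continuous_def
  proof
    fix N :: "real set" assume N: "N \<in> null_sets lborel"
    have "emeasure \<nu> (N \<inter> {a..b}) = 0"
    proof (rule finite_cover_le_imp_null[OF \<nu>s ab _ _ _ M_AC])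
      show "emeasure lborel (N \<inter> {a..b}) = 0" using N
        by (metis null_setsD1 null_set_Int2 sets_lborel atLeastAtMost_borel)
    qed (use N in auto)
    moreover have "N \<inter> {a..b} \<in> sets \<nu>" using null_setsD2[OF N] by simp
    ultimately have "N \<inter> {a..b} \<in> null_sets \<nu>" by (rule null_setsI)
    then have "N \<inter> {a..b} \<union> ((\<Union>n. {b..b + real n}) \<union> (\<Union>n. {a - real n..a})) \<in> null_sets \<nu>"
      using out by (rule null_sets.Un)
    then show "N \<in> null_sets \<nu>"
      by (rule null_sets_subset) (use N cover in auto)
  qed
  obtain h where h: "h \<in> borel_measurable lborel" "density lborel h = \<nu>"
    using sigma_finite_measure.Radon_Nikodym[OF sigma_finite_lborel ac] by auto
  have hI: "(\<integral>\<^sup>+x. h x * indicator A x \<partial>lborel) = emeasure \<nu> A" if "A \<in> sets borel" for A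
    using emeasure_density[OF h(1), of A] that unfolding h(2) by simp
  have "emeasure \<nu> UNIV \<le> emeasure \<nu> {a..b} + emeasure \<nu> ((\<Union>n. {b..b + real n}) \<union> (\<Union>n. {a - real n..a}))"
    by (subst cover, rule emeasure_subadditive) auto
  also have "\<dots> < \<infinity>" using out ab by (simp add: \<nu>Icc null_setsD1)
  finally have hfin: "(\<integral>\<^sup>+x. h x \<partial>lborel) < \<infinity>" using hI[of UNIV] by simp
  then have AEh: "AE x in lborel. ennreal (enn2real (h x)) = h x"
    using nn_integral_PInf_AE[OF h(1)] by (auto simp: less_top intro: ennreal_enn2real)
  have g1: "(\<integral>\<^sup>+x. ennreal (enn2real (h x)) * indicator A x \<partial>lborel) = emeasure \<nu> A" if "A \<in> sets borel" for A
    unfolding hI[OF that, symmetric] using AEh by (intro nn_integral_cong_AE) auto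
  have int: "integrable lborel (\<lambda>x. enn2real (h x))"
    using h(1) hfin g1[of UNIV] hI[of UNIV] by (intro integrableI_nonneg) (auto simp: less_top)
  show ?thesis
  proof (rule that[OF int])
    fix t assume t: "a \<le> t" "t \<le> b"
    have "(LBINT s:{a..t}. enn2real (h s)) = enn2real (\<integral>\<^sup>+x. ennreal (indicator {a..t} x *\<^sub>R enn2real (h x)) \<partial>lborel)"
      unfolding set_lebesgue_integral_def using h(1) by (intro integral_eq_nn_integral) auto
    also have "(\<integral>\<^sup>+x. ennreal (indicator {a..t} x *\<^sub>R enn2real (h x)) \<partial>lborel) =
        (\<integral>\<^sup>+x. ennreal (enn2real (h x)) * indicator {a..t} x \<partial>lborel)"
      by (intro nn_integral_cong) (auto simp: indicator_def)
    also have "\<dots> = ennreal (M t - M a)" using t by (simp add: g1 \<nu>Icc)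
    finally show "G t - G a = (LBINT s:{a..t}. enn2real (h s))"
      using t ab mono[of a t] by (simp add: M_def)
  qed
qed

lemma AC_complex_density:
  assumes AC: "absolutely_continuous_fun_on a b f" and ab: "a < b"
  obtains g :: "real \<Rightarrow> complex" where "integrable lborel g"
    "\<And>t. a \<le> t \<Longrightarrow> t \<le> b \<Longrightarrow> f t - f a = (LBINT s:{a..t}. g s)"
proof -
  have ab': "a \<le> b" using ab by simp
  define V where "V = variation f a"
  have V: "V y - V x = variation f x y" if "a \<le> x" "x \<le> y" "y \<le> b" for x y
    using variation_additive[OF AC ab', of a x y] that by (simp add: V_def)
  have Vf: "cmod (f y - f x) \<le> V y - V x" if "a \<le> x" "x \<le> y" "y \<le> b" for x y
    using norm_diff_le_variation[OF AC ab' that] V[OF that] by simp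
  have VAC: "absolutely_continuous_fun_on a b (\<lambda>x. complex_of_real (V x))"
    using AC_variation[OF AC ab'] by (simp add: V_def)
  have gen: "\<exists>g. integrable lborel g \<and> (\<forall>t. a \<le> t \<longrightarrow> t \<le> b \<longrightarrow> p t - p a = (LBINT s:{a..t}. g s))"
    if p: "\<And>x y. \<bar>p y - p x\<bar> \<le> cmod (f y - f x)" for p :: "real \<Rightarrow> real"
  proof -
    obtain g1 where g1: "integrable lborel g1" "\<And>t. a \<le> t \<Longrightarrow> t \<le> b \<Longrightarrow> V t - V a = (LBINT s:{a..t}. g1 s)"
    proof (rule AC_mono_density[OF _ VAC ab])
      show "V x \<le> V y" if "a \<le> x" "x \<le> y" "y \<le> b" for x y
        using Vf[OF that] norm_ge_zero[of "f y - f x"] by linarith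
    qed (rule that)
    have "absolutely_continuous_fun_on a b (\<lambda>x. complex_of_real (V x - p x))"
    proof (rule AC_dominated[OF VAC AC])
      fix x y assume "a \<le> x" "x \<le> y" "y \<le> b"
      have "\<bar>(V y - p y) - (V x - p x)\<bar> \<le> \<bar>V y - V x\<bar> + cmod (f y - f x)"
        using p[of y x] by linarith
      then show "cmod (complex_of_real (V y - p y) - complex_of_real (V x - p x)) \<le> cmod (complex_of_real (V y) - complex_of_real (V x)) + cmod (f y - f x)"
        by (metis norm_of_real of_real_diff)
    qed
    then obtain g2 where g2: "integrable lborel g2" "\<And>t. a \<le> t \<Longrightarrow> t \<le> b \<Longrightarrow> (V t - p t) - (V a - p a) = (LBINT s:{a..t}. g2 s)"
    proof (rule AC_mono_density[rotated])
      show "V x - p x \<le> V y - p y" if "a \<le> x" "x \<le> y" "y \<le> b" for x y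
        using Vf[OF that] p[of y x] by linarith
    qed (use ab that in auto)
    have si: "set_integrable lborel {a..t} g" if "integrable lborel g" for t and g :: "real \<Rightarrow> real"
      unfolding set_integrable_def using that by (intro integrable_mult_indicator) auto
    have "p t - p a = (LBINT s:{a..t}. g1 s - g2 s)" if "a \<le> t" "t \<le> b" for t
      using g1(2)[OF that] g2(2)[OF that] si[OF g1(1)] si[OF g2(1)] by (simp add: set_integral_diff)
    then show ?thesis using g1(1) g2(1) by (intro exI[of _ "\<lambda>s. g1 s - g2 s"]) auto
  qed
  obtain gr where gr: "integrable lborel gr" "\<And>t. a \<le> t \<Longrightarrow> t \<le> b \<Longrightarrow> Re (f t) - Re (f a) = (LBINT s:{a..t}. gr s)"
    using gen[of "\<lambda>t. Re (f t)"] abs_Re_le_cmod by (metis minus_complex.sel(1))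
  obtain gi where gi: "integrable lborel gi" "\<And>t. a \<le> t \<Longrightarrow> t \<le> b \<Longrightarrow> Im (f t) - Im (f a) = (LBINT s:{a..t}. gi s)"
    using gen[of "\<lambda>t. Im (f t)"] abs_Im_le_cmod by (metis minus_complex.sel(2))
  show ?thesis
  proof (rule that)
    show int: "integrable lborel (\<lambda>s. Complex (gr s) (gi s))"
      unfolding Complex_eq using gr(1) gi(1) by auto
    fix t assume t: "a \<le> t" "t \<le> b"
    have int': "integrable lborel (\<lambda>s. indicat_real {a..t} s *\<^sub>R Complex (gr s) (gi s))"
      using int by (intro integrable_mult_indicator) auto
    show "f t - f a = (LBINT s:{a..t}. Complex (gr s) (gi s))"
      unfolding set_lebesgue_integral_def
      using gr(2)[OF t] gi(2)[OF t] int'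
      by (auto simp: complex_eq_iff set_lebesgue_integral_def simp flip: integral_Re integral_Im)
  qed
qed

lemma AE_indefinite_integral_derivative:
  fixes g :: "real \<Rightarrow> complex"
  assumes g: "integrable lborel g" and f: "\<And>t. a \<le> t \<Longrightarrow> t \<le> b \<Longrightarrow> f t - f a = (LBINT s:{a..t}. g s)"
  shows "AE t in lebesgue. t \<in> {a<..<b} \<longrightarrow> (f has_vector_derivative g t) (at t)"
proof -
  have si: "set_integrable lborel {x..y} g" for x y
    unfolding set_integrable_def using g by (intro integrable_mult_indicator) auto
  have HK: "g integrable_on {x..y}" "(LBINT s:{x..y}. g s) = integral {x..y} g" for x y
    using set_borel_integral_eq_integral[OF si[of x y]] by auto
  obtain N1 where N1: "negligible N1" "\<And>x e. x \<notin> N1 \<Longrightarrow> 0 < e \<Longrightarrow>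
      \<exists>d>0. \<forall>h. 0 < h \<and> h < d \<longrightarrow> norm (integral {x..x + h} g /\<^sub>R h - g x) < e"
    using integrable_ccontinuous_explicit[of g] HK(1) by (auto simp: cbox_interval)
  have HKr: "(\<lambda>s. g (- s)) integrable_on {x..y}" for x y
    using HK(1)[of "-y" "-x"] Henstock_Kurzweil_Integration.integrable_reflect_real[where f=g and a="-y" and b="-x"] by simp
  obtain N2 where N2: "negligible N2" "\<And>x e. x \<notin> N2 \<Longrightarrow> 0 < e \<Longrightarrow>
      \<exists>d>0. \<forall>h. 0 < h \<and> h < d \<longrightarrow> norm (integral {x..x + h} (\<lambda>s. g (- s)) /\<^sub>R h - g (- x)) < e"
    using integrable_ccontinuous_explicit[of "\<lambda>s. g (- s)"] HKr by (auto simp: cbox_interval)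
  have refl: "integral {x..y} (\<lambda>s. g (- s)) = integral {-y..-x} g" for x y
    using Henstock_Kurzweil_Integration.integral_reflect_real[where f=g and a="-y" and b="-x"] by simp
  have "uminus differentiable_on N2"
    by (simp add: differentiable_on_minus differentiable_on_ident)
  then have "negligible (uminus ` N2)"
    using N2(1) by (intro negligible_differentiable_image_negligible) auto
  then have neg: "negligible (N1 \<union> uminus ` N2)"
    using N1(1) by simp
  have diff: "f y - f x = integral {x..y} g" if "a \<le> x" "x \<le> y" "y \<le> b" for x y
  proof -
    have "integral {a..y} g = integral {a..x} g + integral {x..y} g"
      using that HK(1)[of a y] by (simp add: Henstock_Kurzweil_Integration.integral_combine)
    then show ?thesis using f[of x] f[of y] that HK(2) by (simp add: algebra_simps)
  qed
  have main: "(f has_vector_derivative g t) (at t)" if t: "t \<in> {a<..<b}" "t \<notin> N1 \<union> uminus ` N2" for t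
    unfolding has_vector_derivative_def has_derivative_at_alt
  proof (intro conjI allI impI)
    show "bounded_linear (\<lambda>x. x *\<^sub>R g t)" by (rule bounded_linear_scaleR_left)
    fix e :: real assume e: "0 < e"
    have t2: "- t \<notin> N2" using t by (metis UnI2 image_iff minus_minus)
    obtain d1 where d1: "d1 > 0" "\<And>h. 0 < h \<Longrightarrow> h < d1 \<Longrightarrow> norm (integral {t..t + h} g /\<^sub>R h - g t) < e"
      using N1(2)[of t e] t e by auto
    obtain d2 where d2: "d2 > 0" "\<And>h. 0 < h \<Longrightarrow> h < d2 \<Longrightarrow> norm (integral {-t..-t + h} (\<lambda>s. g (- s)) /\<^sub>R h - g t) < e"
      using N2(2)[OF t2 e] by auto
    have scale: "norm (w - h *\<^sub>R z) \<le> e * h" if "0 < h" "norm (w /\<^sub>R h - z) < e" for w z :: complex and h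
    proof -
      have "w - h *\<^sub>R z = h *\<^sub>R (w /\<^sub>R h - z)" using that by (simp add: scaleR_diff_right)
      then have "norm (w - h *\<^sub>R z) = h * norm (w /\<^sub>R h - z)" using that by simp
      then show ?thesis using that by (simp add: mult.commute less_imp_le)
    qed
    show "\<exists>d>0. \<forall>y. norm (y - t) < d \<longrightarrow> norm (f y - f t - (y - t) *\<^sub>R g t) \<le> e * norm (y - t)"
    proof (intro exI conjI allI impI)
      show "0 < min (min d1 d2) (min (t - a) (b - t))" using d1 d2 t by auto
      fix y assume y: "norm (y - t) < min (min d1 d2) (min (t - a) (b - t))"
      consider "y = t" | "t < y" | "y < t" by linarith
      then show "norm (f y - f t - (y - t) *\<^sub>R g t) \<le> e * norm (y - t)"
      proof cases
        case 2
        then have "f y - f t = integral {t..t + (y - t)} g" using diff[of t y] y t by auto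
        then show ?thesis using scale[OF _ d1(2)[of "y - t"]] 2 y by simp
      next
        case 3
        then have "f t - f y = integral {-t..-t + (t - y)} (\<lambda>s. g (- s))"
          using diff[of y t] y t by (auto simp: refl)
        then have "norm (f t - f y - (t - y) *\<^sub>R g t) \<le> e * (t - y)"
          using scale[OF _ d2(2)[of "t - y"]] 3 y by simp
        moreover have "f y - f t - (y - t) *\<^sub>R g t = - (f t - f y - (t - y) *\<^sub>R g t)"
          by (simp add: algebra_simps)
        ultimately show ?thesis using 3 by (simp only: norm_minus_cancel) simp
      qed simp
    qed
  qed
  show ?thesis
    using neg main by (intro AE_I'[of "N1 \<union> uminus ` N2"]) (auto simp: negligible_iff_null_sets)
qed

section \<open>Gamma integrals and convolutions\<close>

lemma has_bochner_integral_nonneg_has_integral: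
  fixes f :: "real \<Rightarrow> real"
  assumes "f \<in> borel_measurable borel" "\<And>x. 0 \<le> f x" "(f has_integral I) UNIV"
  shows "has_bochner_integral lborel f I"
proof -
  have "0 \<le> I" using has_integral_nonneg[OF assms(3)] assms(2) by simp
  moreover have "(\<integral>\<^sup>+x. f x \<partial>lborel) = ennreal I"
    by (rule nn_integral_has_integral_lborel[OF assms(1,2,3)])
  ultimately show ?thesis using assms by (intro has_bochner_integral_nn_integral) auto
qed

definition trunc_powr :: "real \<Rightarrow> real \<Rightarrow> real \<Rightarrow> real" where
  "trunc_powr b T x = (if 0 < x \<and> x \<le> T then x powr b else 0)"

lemma trunc_powr_measurable[measurable]: "trunc_powr b T \<in> borel_measurable borel"
  unfolding trunc_powr_def by measurable

lemma trunc_powr_nonneg: "0 \<le> trunc_powr b T x" by (simp add: trunc_powr_def)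

lemma trunc_powr_integral:
  assumes "-1 < b" "0 \<le> T"
  shows "has_bochner_integral lborel (trunc_powr b T) (T powr (b + 1) / (b + 1))"
proof (rule has_bochner_integral_nonneg_has_integral[OF trunc_powr_measurable trunc_powr_nonneg])
  have "((\<lambda>x. x powr b) has_integral (T powr (b + 1) / (b + 1))) {0..T}"
    using has_integral_powr_from_0[OF assms] .
  from iffD2[OF has_integral_restrict_UNIV this] have "((\<lambda>x. if x \<in> {0..T} then x powr b else 0) has_integral (T powr (b + 1) / (b + 1))) UNIV"
    by simp
  then show "(trunc_powr b T has_integral (T powr (b + 1) / (b + 1))) UNIV"
    by (rule has_integral_spike[of "{0}", rotated 2]) (auto simp: trunc_powr_def)
qed

lemma trunc_powr_integrable: "-1 < b \<Longrightarrow> 0 \<le> T \<Longrightarrow> integrable lborel (trunc_powr b T)"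
  using trunc_powr_integral has_bochner_integral_iff by blast

lemma real_gamma_kernel_integral:
  fixes a s :: real
  assumes "0 < a" "0 < s"
  shows "has_bochner_integral lborel (\<lambda>r. indicator {0<..} r *\<^sub>R (r powr (a - 1) * exp (- (s * r)))) (Gamma a * s powr (- a))"
proof -
  have 1: "has_bochner_integral lborel (\<lambda>r. indicator {0<..} r *\<^sub>R (r powr (a - 1) * exp (- r))) (Gamma a)"
  proof (rule has_bochner_integral_nonneg_has_integral)
    have "((\<lambda>t. if t \<in> {0..} then t powr (a - 1) / exp t else 0) has_integral Gamma a) UNIV"
      by (rule iffD2[OF has_integral_restrict_UNIV Gamma_integral_real[OF assms(1)]])
    then show "((\<lambda>r. indicator {0<..} r *\<^sub>R (r powr (a - 1) * exp (- r))) has_integral Gamma a) UNIV"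
      by (rule has_integral_spike[of "{0}", rotated 2]) (auto simp: exp_minus field_simps indicator_def)
  qed (auto simp: indicator_def)
  have "has_bochner_integral lborel (\<lambda>r. indicator {0<..} (0 + s * r) *\<^sub>R ((0 + s * r) powr (a - 1) * exp (- (0 + s * r)))) (Gamma a /\<^sub>R \<bar>s\<bar>)"
    using 1 assms by (subst lborel_has_bochner_integral_real_affine_iff[symmetric]) auto
  then have "has_bochner_integral lborel (\<lambda>r. s powr (1 - a) * (indicator {0<..} (0 + s * r) *\<^sub>R ((0 + s * r) powr (a - 1) * exp (- (0 + s * r))))) (s powr (1 - a) * (Gamma a /\<^sub>R \<bar>s\<bar>))"
    by (rule has_bochner_integral_mult_right)
  also have "(\<lambda>r. s powr (1 - a) * (indicator {0<..} (0 + s * r) *\<^sub>R ((0 + s * r) powr (a - 1) * exp (- (0 + s * r))))) =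
     (\<lambda>r. indicator {0<..} r *\<^sub>R (r powr (a - 1) * exp (- (s * r))))"
  proof
    fix r
    have "s powr (1 - a) * (s * r) powr (a - 1) = r powr (a - 1)" if "r > 0"
      using that assms by (simp add: powr_mult mult.assoc[symmetric] powr_add[symmetric])
    then show "s powr (1 - a) * (indicator {0<..} (0 + s * r) *\<^sub>R ((0 + s * r) powr (a - 1) * exp (- (0 + s * r)))) =
       indicator {0<..} r *\<^sub>R (r powr (a - 1) * exp (- (s * r)))"
      using assms by (auto simp: indicator_def zero_less_mult_iff mult.assoc[symmetric])
  qed
  also have "s powr (1 - a) * (Gamma a /\<^sub>R \<bar>s\<bar>) = Gamma a * s powr (- a)"
    using assms by (simp add: powr_diff powr_minus field_simps)
  finally show ?thesis .
qed

definition gamma_kernel :: "real \<Rightarrow> complex \<Rightarrow> real \<Rightarrow> complex" where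
  "gamma_kernel a z r = indicator {0<..} r *\<^sub>R (of_real (r powr (a - 1)) * exp (- (z * of_real r)))"

lemma gamma_kernel_measurable[measurable]: "gamma_kernel a z \<in> borel_measurable borel"
  unfolding gamma_kernel_def by measurable

lemma norm_gamma_kernel: "cmod (gamma_kernel a z r) = indicator {0<..} r *\<^sub>R (r powr (a - 1) * exp (- (Re z * r)))"
  by (simp add: gamma_kernel_def norm_mult indicator_def)

lemma real_gamma_kernel_integrable:
  fixes a s :: real
  assumes "0 < a" "0 < s" shows "integrable lborel (\<lambda>r. indicator {0<..} r *\<^sub>R (r powr (a - 1) * exp (- (s * r))))"
  using real_gamma_kernel_integral[OF assms] has_bochner_integral_iff by blast

lemma gamma_kernel_integrable:
  assumes "0 < a" "0 < Re z" shows "integrable lborel (gamma_kernel a z)"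
  using real_gamma_kernel_integrable[OF assms] by (rule Bochner_Integration.integrable_bound) (auto simp: norm_gamma_kernel)

lemma gamma_kernel_integral_holomorphic:
  assumes a: "0 < a"
  shows "(\<lambda>z. \<integral>r. gamma_kernel a z r \<partial>lborel) holomorphic_on {z. 0 < Re z}"
proof (rule holomorphic_uniform_sequence[where f="\<lambda>n z. integral (cbox (1 / real (Suc n)) (real (Suc n))) (\<lambda>r. of_real (r powr (a - 1)) * exp (- (z * of_real r)))"])
  show "open {z. 0 < Re z}" by (rule open_halfspace_Re_gt)
  show "(\<lambda>z. integral (cbox (1 / real (Suc n)) (real (Suc n))) (\<lambda>r. of_real (r powr (a - 1)) * exp (- (z * of_real r)))) holomorphic_on {z. 0 < Re z}" for n
  proof (rule leibniz_rule_holomorphic)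
    fix z r assume "r \<in> cbox (1 / real (Suc n)) (real (Suc n))"
    show "((\<lambda>z. of_real (r powr (a - 1)) * exp (- (z * of_real r))) has_field_derivative
      of_real (r powr (a - 1)) * (- of_real r * exp (- (z * of_real r)))) (at z within {z. 0 < Re z})"
      by (auto intro!: derivative_eq_intros)
  next
    have *: "x > 0" if "x \<in> cbox (1 / real (Suc n)) (real (Suc n))" for x
      using that by (auto intro: less_le_trans[rotated])
    show "(\<lambda>r. of_real (r powr (a - 1)) * exp (- (z * of_real r))) integrable_on cbox (1 / real (Suc n)) (real (Suc n))" for z :: complex
      by (intro integrable_continuous continuous_intros) (use * in auto)
    show "continuous_on ({z. 0 < Re z} \<times> cbox (1 / real (Suc n)) (real (Suc n)))
       (\<lambda>(z, r). of_real (r powr (a - 1)) * (- of_real r * exp (- (z * of_real r))))"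
      unfolding case_prod_unfold by (intro continuous_intros) (use * in auto)
    show "convex {z. 0 < Re z}" by (rule convex_halfspace_Re_gt)
  qed
  fix z assume "z \<in> {z. 0 < Re z}"
  then have z: "0 < Re z" by simp
  define d where "d = Re z / 2"
  have d: "0 < d" using z by (simp add: d_def)
  have Re_ge: "d \<le> Re y" if "y \<in> cball z d" for y
    using that abs_Re_le_cmod[of "z - y"] by (auto simp: dist_norm d_def)
  let ?J = "\<lambda>n. {1 / real (Suc n)..real (Suc n)}"
  let ?g = "\<lambda>r. indicator {0<..} r *\<^sub>R (r powr (a - 1) * exp (- (d * r)))"
  define R where "R n = (\<integral>r. indicator (- ?J n) r *\<^sub>R ?g r \<partial>lborel)" for n
  have gi: "integrable lborel ?g" by (rule real_gamma_kernel_integrable[OF a d])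
  have "(\<lambda>n. R n) \<longlonglongrightarrow> (\<integral>r. 0 \<partial>(lborel::real measure))"
    unfolding R_def
  proof (rule integral_dominated_convergence[OF _ _ gi])
    show "AE r in lborel. (\<lambda>n. indicator (- ?J n) r *\<^sub>R ?g r) \<longlonglongrightarrow> 0"
    proof (rule AE_I2)
      fix r :: real
      show "(\<lambda>n. indicator (- ?J n) r *\<^sub>R ?g r) \<longlonglongrightarrow> 0"
      proof (cases "0 < r")
        case True
        have "\<forall>\<^sub>F n in sequentially. 1 / real (Suc n) < r"
          using True LIMSEQ_inverse_real_of_nat order_tendstoD(2)[of "\<lambda>n. inverse (real (Suc n))" 0 sequentially r]
          by (simp add: inverse_eq_divide)
        moreover have "\<forall>\<^sub>F n in sequentially. r \<le> real (Suc n)"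
        proof -
          obtain N where "r \<le> real N" using real_arch_simple by blast
          then show ?thesis by (intro eventually_sequentiallyI[of N]) auto
        qed
        ultimately have "\<forall>\<^sub>F n in sequentially. indicator (- ?J n) r *\<^sub>R ?g r = 0"
          by eventually_elim auto
        then show ?thesis by (rule tendsto_eventually)
      qed simp
    qed
  qed (auto simp: indicator_def)
  then have R0: "R \<longlonglongrightarrow> 0" by simp
  have bound: "cmod (integral (cbox (1 / real (Suc n)) (real (Suc n))) (\<lambda>r. of_real (r powr (a - 1)) * exp (- (y * of_real r))) - (\<integral>r. gamma_kernel a y r \<partial>lborel)) \<le> R n"
    if y: "y \<in> cball z d" for n y
  proof -
    have gy: "integrable lborel (gamma_kernel a y)" using Re_ge[OF y] d by (intro gamma_kernel_integrable[OF a]) auto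
    have gs: "set_integrable lborel A (gamma_kernel a y)" if "A \<in> sets borel" for A
      unfolding set_integrable_def using gy that by (intro integrable_mult_indicator) auto
    have "integral (cbox (1 / real (Suc n)) (real (Suc n))) (\<lambda>r. of_real (r powr (a - 1)) * exp (- (y * of_real r))) =
      integral (?J n) (gamma_kernel a y)"
      unfolding cbox_interval
    proof (rule integral_cong)
      fix r assume "r \<in> ?J n"
      then have "0 < r" by (auto intro: less_le_trans[rotated])
      then show "of_real (r powr (a - 1)) * exp (- (y * of_real r)) = gamma_kernel a y r" by (simp add: gamma_kernel_def)
    qed
    also have "\<dots> = (LBINT r:?J n. gamma_kernel a y r)"
      using set_borel_integral_eq_integral(2)[OF gs[of "?J n"]] by simp
    finally have "integral (cbox (1 / real (Suc n)) (real (Suc n))) (\<lambda>r. of_real (r powr (a - 1)) * exp (- (y * of_real r))) - (\<integral>r. gamma_kernel a y r \<partial>lborel)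
      = (\<integral>r. indicator (?J n) r *\<^sub>R gamma_kernel a y r - gamma_kernel a y r \<partial>lborel)"
      using gs[of "?J n"] gy unfolding set_lebesgue_integral_def set_integrable_def by simp
    also have "cmod \<dots> \<le> R n"
      unfolding R_def
    proof (rule Bochner_Integration.integral_norm_bound_integral)
      show "integrable lborel (\<lambda>r. indicator (?J n) r *\<^sub>R gamma_kernel a y r - gamma_kernel a y r)"
        using gs[of "?J n"] gy unfolding set_integrable_def by simp
      show "integrable lborel (\<lambda>r. indicator (- ?J n) r *\<^sub>R ?g r)"
        by (rule integrable_mult_indicator[OF _ gi]) simp
      fix r
      show "cmod (indicator (?J n) r *\<^sub>R gamma_kernel a y r - gamma_kernel a y r) \<le> indicator (- ?J n) r *\<^sub>R ?g r"
        using Re_ge[OF y] by (cases "r \<in> ?J n"; cases "0 < r") (auto simp: norm_gamma_kernel intro!: mult_left_mono mult_right_mono)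
    qed
    finally show ?thesis .
  qed
  have ul: "uniform_limit (cball z d) (\<lambda>n z. integral (cbox (1 / real (Suc n)) (real (Suc n))) (\<lambda>r. of_real (r powr (a - 1)) * exp (- (z * of_real r)))) (\<lambda>z. \<integral>r. gamma_kernel a z r \<partial>lborel) sequentially"
  proof (rule uniform_limitI)
    fix e :: real assume "0 < e"
    with R0 have "\<forall>\<^sub>F n in sequentially. R n < e" by (rule order_tendstoD)
    then show "\<forall>\<^sub>F n in sequentially. \<forall>y\<in>cball z d. dist (integral (cbox (1 / real (Suc n)) (real (Suc n))) (\<lambda>r. of_real (r powr (a - 1)) * exp (- (y * of_real r)))) (\<integral>r. gamma_kernel a y r \<partial>lborel) < e"
      by eventually_elim (use bound in \<open>fastforce simp: dist_norm intro: le_less_trans\<close>)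
  qed
  show "\<exists>d>0. cball z d \<subseteq> {z. 0 < Re z} \<and> uniform_limit (cball z d) (\<lambda>n z. integral (cbox (1 / real (Suc n)) (real (Suc n))) (\<lambda>r. of_real (r powr (a - 1)) * exp (- (z * of_real r)))) (\<lambda>z. \<integral>r. gamma_kernel a z r \<partial>lborel) sequentially"
    using d ul Re_ge by (intro exI[of _ d]) force
qed

lemma gamma_kernel_integral:
  assumes a: "0 < a" and z: "0 < Re z"
  shows "(\<integral>r. gamma_kernel a z r \<partial>lborel) = of_real (Gamma a) * z powr (- of_real a)"
proof -
  have "(\<integral>r. gamma_kernel a z r \<partial>lborel) - of_real (Gamma a) * z powr (- of_real a) = 0"
  proof (rule analytic_continuation[where f="\<lambda>z. (\<integral>r. gamma_kernel a z r \<partial>lborel) - of_real (Gamma a) * z powr (- of_real a)" and w=z and S="{z. 0 < Re z}" and U="of_real ` {0<..}" and \<xi>=1])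
    show "(\<lambda>z. (\<integral>r. gamma_kernel a z r \<partial>lborel) - of_real (Gamma a) * z powr (- of_real a)) holomorphic_on {z. 0 < Re z}"
      by (intro holomorphic_intros gamma_kernel_integral_holomorphic[OF a]) (auto simp: complex_nonpos_Reals_iff)
    show "open {z. 0 < Re z}" by (rule open_halfspace_Re_gt)
    show "connected {z. 0 < Re z}" by (intro convex_connected convex_halfspace_Re_gt)
    show "(1::complex) islimpt of_real ` {0<..}"
    proof -
      have "(1::real) islimpt {0<..}" by (intro interior_limit_point) (simp add: interior_open)
      then show ?thesis
        unfolding islimpt_approachable
        by (smt (verit, best) dist_of_real greaterThan_iff image_iff of_real_1 of_real_eq_iff)
    qed
    show "(\<integral>r. gamma_kernel a w r \<partial>lborel) - of_real (Gamma a) * w powr (- of_real a) = 0" if w: "w \<in> of_real ` {0<..}" for w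
    proof -
      obtain s where s: "w = of_real s" "0 < s" using w by auto
      have "(\<integral>r. gamma_kernel a w r \<partial>lborel) = (\<integral>r. complex_of_real (indicator {0<..} r *\<^sub>R (r powr (a - 1) * exp (- (s * r)))) \<partial>lborel)"
        by (intro Bochner_Integration.integral_cong) (auto simp: gamma_kernel_def s indicator_def exp_of_real[symmetric])
      also have "\<dots> = of_real (Gamma a * s powr (- a))"
        using real_gamma_kernel_integral[OF a s(2)] by (simp only: integral_complex_of_real has_bochner_integral_integral_eq)
      also have "\<dots> = of_real (Gamma a) * w powr (- of_real a)"
        using s by (simp add: powr_of_real flip: of_real_minus)
      finally show ?thesis by simp
    qed
  qed (use z in auto)
  then show ?thesis by simp
qed

lemma Fubini_bounded_kernel:
  fixes p q :: "real \<Rightarrow> complex" and h :: "real \<Rightarrow> real \<Rightarrow> complex"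
  assumes p: "integrable lborel p" and q: "integrable lborel q"
    and h[measurable]: "case_prod h \<in> borel_measurable (borel \<Otimes>\<^sub>M borel)" and h1: "\<And>x y. cmod (h x y) \<le> 1"
  shows "(\<integral>x. p x * (\<integral>y. q y * h x y \<partial>lborel) \<partial>lborel) = (\<integral>y. q y * (\<integral>x. p x * h x y \<partial>lborel) \<partial>lborel)"
proof -
  have [measurable]: "p \<in> borel_measurable borel" "q \<in> borel_measurable borel" using p q by auto
  have "integrable (lborel \<Otimes>\<^sub>M lborel) (\<lambda>(x, y). p x * q y)"
  proof (rule lborel_pair.Fubini_integrable)
    show "integrable lborel (\<lambda>x. \<integral>y. norm (case (x, y) of (x, y) \<Rightarrow> p x * q y) \<partial>lborel)"
      using p by (simp add: norm_mult)
  qed (use q in auto)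
  then have int: "integrable (lborel \<Otimes>\<^sub>M lborel) (\<lambda>(x, y). p x * q y * h x y)"
    by (rule Bochner_Integration.integrable_bound) (use h1 in \<open>auto simp: norm_mult mult_left_le\<close>)
  have eq: "(\<integral>x. (\<integral>y. p x * q y * h x y \<partial>lborel) \<partial>lborel) = (\<integral>y. (\<integral>x. p x * q y * h x y \<partial>lborel) \<partial>lborel)"
    using lborel_pair.Fubini_integral[OF int] by simp
  have A: "(\<integral>y. p x * q y * h x y \<partial>lborel) = p x * (\<integral>y. q y * h x y \<partial>lborel)" for x
    by (simp add: mult.assoc)
  have B: "(\<integral>x. p x * q y * h x y \<partial>lborel) = q y * (\<integral>x. p x * h x y \<partial>lborel)" for y
    by (simp add: mult.assoc mult.left_commute[of _ "q y"])
  show ?thesis using eq unfolding A B .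
qed

lemma convolution_kernel_integrable:
  fixes p q k :: "real \<Rightarrow> complex"
  assumes p[measurable]: "p \<in> borel_measurable borel" "\<And>x. cmod (p x) \<le> C" and q: "integrable lborel q" and k: "integrable lborel k"
  shows "integrable (lborel \<Otimes>\<^sub>M lborel) (\<lambda>(y, x). p x * k (x - y) * q y)"
proof -
  have [measurable]: "k \<in> borel_measurable borel" "q \<in> borel_measurable borel" using k q by auto
  have kx: "integrable lborel (\<lambda>x. k (x - y))" for y
    using lborel_integrable_real_affine[OF k, of 1 "-y"] by (simp add: algebra_simps)
  have knorm: "(\<integral>x. cmod (k (x - y)) \<partial>lborel) = (\<integral>x. cmod (k x) \<partial>lborel)" for y
    using lborel_integral_real_affine[of 1 "\<lambda>x. cmod (k x)" "-y"] by (simp add: algebra_simps)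
  have pkx: "integrable lborel (\<lambda>x. p x * k (x - y))" for y
  proof (rule Bochner_Integration.integrable_bound[where f="\<lambda>x. of_real C * k (x - y)"])
    show "integrable lborel (\<lambda>x. of_real C * k (x - y))" using kx by simp
    show "AE x in lborel. norm (p x * k (x - y)) \<le> norm (of_real C * k (x - y))"
      using p(2) by (auto simp: norm_mult intro!: mult_right_mono order_trans[OF p(2)])
  qed auto
  show ?thesis
  proof (rule lborel_pair.Fubini_integrable)
    show "integrable lborel (\<lambda>y. \<integral>x. norm (case (y, x) of (y, x) \<Rightarrow> p x * k (x - y) * q y) \<partial>lborel)"
    proof (rule Bochner_Integration.integrable_bound[where f="\<lambda>y. of_real (C * (\<integral>x. cmod (k x) \<partial>lborel)) * q y"])
      show "integrable lborel (\<lambda>y. of_real (C * (\<integral>x. cmod (k x) \<partial>lborel)) * q y)" using q by simp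
      show "AE y in lborel. norm (\<integral>x. norm (case (y, x) of (y, x) \<Rightarrow> p x * k (x - y) * q y) \<partial>lborel)
         \<le> norm (of_real (C * (\<integral>x. cmod (k x) \<partial>lborel)) * q y)"
      proof (rule AE_I2)
        fix y
        have "(\<integral>x. cmod (p x * k (x - y)) \<partial>lborel) \<le> (\<integral>x. C * cmod (k (x - y)) \<partial>lborel)"
        proof (rule integral_mono)
          show "integrable lborel (\<lambda>x. cmod (p x * k (x - y)))" by (rule integrable_norm[OF pkx])
          show "integrable lborel (\<lambda>x. C * cmod (k (x - y)))"
            by (rule integrable_mult_right[OF integrable_norm[OF kx]])
        qed (auto simp: norm_mult intro!: mult_right_mono p(2))
        also have "\<dots> = C * (\<integral>x. cmod (k x) \<partial>lborel)" by (simp add: knorm)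
        finally have "(\<integral>x. cmod (p x * k (x - y)) \<partial>lborel) * cmod (q y) \<le> C * (\<integral>x. cmod (k x) \<partial>lborel) * cmod (q y)"
          by (rule mult_right_mono) simp
        moreover have "0 \<le> C" using p(2)[of 0] norm_ge_zero order_trans by blast
        ultimately show "norm (\<integral>x. norm (case (y, x) of (y, x) \<Rightarrow> p x * k (x - y) * q y) \<partial>lborel)
         \<le> norm (of_real (C * (\<integral>x. cmod (k x) \<partial>lborel)) * q y)"
          by (simp add: norm_mult del: of_real_mult)
      qed
    qed auto
  qed (use pkx in auto)
qed

lemma Fubini_convolution:
  fixes p q k :: "real \<Rightarrow> complex"
  assumes "p \<in> borel_measurable borel" "\<And>x. cmod (p x) \<le> C" "integrable lborel q" "integrable lborel k"
  shows "(\<integral>x. p x * (\<integral>y. k (x - y) * q y \<partial>lborel) \<partial>lborel) = (\<integral>y. q y * (\<integral>x. p x * k (x - y) \<partial>lborel) \<partial>lborel)"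
proof -
  have eq: "(\<integral>x. \<integral>y. p x * k (x - y) * q y \<partial>lborel \<partial>lborel) = (\<integral>y. \<integral>x. p x * k (x - y) * q y \<partial>lborel \<partial>lborel)"
    using lborel_pair.Fubini_integral[of "\<lambda>y x. p x * k (x - y) * q y"] convolution_kernel_integrable[OF assms] by simp
  have A: "(\<integral>y. p x * k (x - y) * q y \<partial>lborel) = p x * (\<integral>y. k (x - y) * q y \<partial>lborel)" for x
    by (simp add: mult.assoc)
  have B: "(\<integral>x. p x * k (x - y) * q y \<partial>lborel) = q y * (\<integral>x. p x * k (x - y) \<partial>lborel)" for y
    by (simp add: mult.commute[of _ "q y"])
  show ?thesis using eq unfolding A B .
qed

section \<open>Positivity of the rotated kernel\<close>

text \<open>The kernel is the Fourier transform of a positive density, since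
  \<open>(\<epsilon> - \<i> x)\<^sup>-\<^sup>a = \<Gamma>(a)\<^sup>-\<^sup>1 \<integral> r\<^sup>a\<^sup>-\<^sup>1 exp(-\<epsilon> r) exp(\<i> r x) dr\<close>.\<close>

lemma regularized_kernel_positive:
  fixes w :: "real \<Rightarrow> complex"
  assumes a: "0 < a" and e: "0 < \<epsilon>" and w: "integrable lborel w"
  shows "0 \<le> Re (\<integral>t. cnj (w t) * (\<integral>s. w s * (of_real \<epsilon> - \<i> * of_real (t - s)) powr (- of_real a) \<partial>lborel) \<partial>lborel)"
proof -
  have wm[measurable]: "w \<in> borel_measurable borel" using w by auto
  define \<rho> where "\<rho> = gamma_kernel a (of_real \<epsilon>)"
  have \<rho>: "integrable lborel \<rho>" unfolding \<rho>_def by (rule gamma_kernel_integrable[OF a]) (use e in auto)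
  have [measurable]: "\<rho> \<in> borel_measurable borel" by (simp add: \<rho>_def)
  define E where "E x r = exp (\<i> * of_real (r * x))" for x r :: real
  have E1: "cmod (E x r) = 1" for x r by (simp add: E_def)
  have [measurable]: "case_prod E \<in> borel_measurable (borel \<Otimes>\<^sub>M borel)"
    unfolding E_def case_prod_unfold by measurable
  have Eadd: "E (x + y) r = E x r * E y r" for x y r
    by (simp add: E_def ring_distribs exp_add)
  have Ecnj: "cnj (E x r) = E (- x) r" for x r
    by (simp add: E_def exp_cnj)
  have kern: "of_real (Gamma a) * (of_real \<epsilon> - \<i> * of_real x) powr (- of_real a) = (\<integral>r. \<rho> r * E x r \<partial>lborel)" for x
  proof -
    have "gamma_kernel a (of_real \<epsilon> - \<i> * of_real x) r = \<rho> r * E x r" for r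
      by (simp add: gamma_kernel_def \<rho>_def E_def algebra_simps exp_add[symmetric])
    then show ?thesis using gamma_kernel_integral[OF a, of "of_real \<epsilon> - \<i> * of_real x"] e by simp
  qed
  define W where "W r = (\<integral>s. w s * E (- s) r \<partial>lborel)" for r
  have [measurable]: "W \<in> borel_measurable borel" unfolding W_def by measurable
  have wE: "integrable lborel (\<lambda>s. w s * E (x s) r)" if "x \<in> borel_measurable borel" for x r
    using w by (rule Bochner_Integration.integrable_bound) (use that in \<open>auto simp: norm_mult E1\<close>)
  have Wb: "cmod (W r) \<le> (\<integral>s. cmod (w s) \<partial>lborel)" for r
    unfolding W_def by (rule order_trans[OF integral_norm_bound]) (simp add: norm_mult E1)
  have \<rho>W: "integrable lborel (\<lambda>r. \<rho> r * W r)"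
  proof (rule Bochner_Integration.integrable_bound[where f="\<lambda>r. \<rho> r * of_real (\<integral>s. cmod (w s) \<partial>lborel)"])
    show "AE r in lborel. norm (\<rho> r * W r) \<le> norm (\<rho> r * of_real (\<integral>s. cmod (w s) \<partial>lborel))"
      using Wb by (auto simp: norm_mult intro!: mult_left_mono order_trans[OF Wb])
  qed (use \<rho> in auto)
  have inner: "of_real (Gamma a) * (\<integral>s. w s * (of_real \<epsilon> - \<i> * of_real (t - s)) powr (- of_real a) \<partial>lborel)
      = (\<integral>r. (\<rho> r * W r) * E t r \<partial>lborel)" for t
  proof -
    have "of_real (Gamma a) * (\<integral>s. w s * (of_real \<epsilon> - \<i> * of_real (t - s)) powr (- of_real a) \<partial>lborel)
      = (\<integral>s. w s * (of_real (Gamma a) * (of_real \<epsilon> - \<i> * of_real (t - s)) powr (- of_real a)) \<partial>lborel)"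
      by (simp only: integral_mult_right_zero[symmetric] mult.left_commute)
    also have "\<dots> = (\<integral>s. w s * (\<integral>r. \<rho> r * E (t - s) r \<partial>lborel) \<partial>lborel)"
      by (simp only: kern)
    also have "\<dots> = (\<integral>r. \<rho> r * (\<integral>s. w s * E (t - s) r \<partial>lborel) \<partial>lborel)"
      using E1 by (intro Fubini_bounded_kernel w \<rho>) (auto simp: E_def)
    also have "\<dots> = (\<integral>r. (\<rho> r * W r) * E t r \<partial>lborel)"
    proof (rule Bochner_Integration.integral_cong)
      fix r
      have "(\<integral>s. w s * E (t - s) r \<partial>lborel) = (\<integral>s. w s * E (- s) r * E t r \<partial>lborel)"
        using Eadd[of t "- s" r for s] by (simp add: mult_ac)
      also have "\<dots> = W r * E t r" by (simp add: W_def)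
      finally show "\<rho> r * (\<integral>s. w s * E (t - s) r \<partial>lborel) = (\<rho> r * W r) * E t r" by simp
    qed simp
    finally show ?thesis .
  qed
  have "of_real (Gamma a) * (\<integral>t. cnj (w t) * (\<integral>s. w s * (of_real \<epsilon> - \<i> * of_real (t - s)) powr (- of_real a) \<partial>lborel) \<partial>lborel)
    = (\<integral>t. cnj (w t) * (of_real (Gamma a) * (\<integral>s. w s * (of_real \<epsilon> - \<i> * of_real (t - s)) powr (- of_real a) \<partial>lborel)) \<partial>lborel)"
    by (simp only: integral_mult_right_zero[symmetric] mult.left_commute)
  also have "\<dots> = (\<integral>t. cnj (w t) * (\<integral>r. (\<rho> r * W r) * E t r \<partial>lborel) \<partial>lborel)"
    by (simp only: inner)
  also have "\<dots> = (\<integral>r. (\<rho> r * W r) * (\<integral>t. cnj (w t) * E t r \<partial>lborel) \<partial>lborel)"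
    using E1 w \<rho>W by (intro Fubini_bounded_kernel) auto
  also have "\<dots> = (\<integral>r. complex_of_real (cmod (\<rho> r) * (cmod (W r))\<^sup>2) \<partial>lborel)"
  proof (rule Bochner_Integration.integral_cong)
    fix r
    have "(\<integral>t. cnj (w t) * E t r \<partial>lborel) = (\<integral>t. cnj (w t * E (- t) r) \<partial>lborel)"
      by (simp add: Ecnj)
    also have "\<dots> = cnj (W r)" unfolding W_def by (simp only: Bochner_Integration.integral_cnj)
    finally have 1: "(\<integral>t. cnj (w t) * E t r \<partial>lborel) = cnj (W r)" .
    have "\<rho> r = of_real (cmod (\<rho> r))"
      using norm_gamma_kernel[of a "of_real \<epsilon>" r]
      by (auto simp: \<rho>_def gamma_kernel_def indicator_def exp_of_real[symmetric])
    then show "(\<rho> r * W r) * (\<integral>t. cnj (w t) * E t r \<partial>lborel) = complex_of_real (cmod (\<rho> r) * (cmod (W r))\<^sup>2)"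
      unfolding 1 using complex_norm_square[of "W r"] by (metis mult.assoc of_real_mult)
  qed simp
  also have "\<dots> = complex_of_real (\<integral>r. cmod (\<rho> r) * (cmod (W r))\<^sup>2 \<partial>lborel)"
    by (rule integral_complex_of_real)
  finally have eq: "of_real (Gamma a) * (\<integral>t. cnj (w t) * (\<integral>s. w s * (of_real \<epsilon> - \<i> * of_real (t - s)) powr (- of_real a) \<partial>lborel) \<partial>lborel)
    = complex_of_real (\<integral>r. cmod (\<rho> r) * (cmod (W r))\<^sup>2 \<partial>lborel)" .
  have "Gamma a * Re (\<integral>t. cnj (w t) * (\<integral>s. w s * (of_real \<epsilon> - \<i> * of_real (t - s)) powr (- of_real a) \<partial>lborel) \<partial>lborel)
     = (\<integral>r. cmod (\<rho> r) * (cmod (W r))\<^sup>2 \<partial>lborel)"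
    using arg_cong[OF eq, of Re] by simp
  also have "\<dots> \<ge> 0" by (intro integral_nonneg_AE) auto
  finally show ?thesis using Gamma_real_pos[OF a] by (simp add: zero_le_mult_iff)
qed

lemma kernel_limit:
  assumes "x \<noteq> 0" "0 < a"
  shows "(\<lambda>n. (of_real (1 / real (Suc n)) - \<i> * of_real x) powr (- of_real a)) \<longlonglongrightarrow>
    of_real (\<bar>x\<bar> powr (- a)) * exp (\<i> * of_real (sgn x * (pi * a / 2)))"
proof -
  have "(- (\<i> * of_real x)) powr (- of_real a) = of_real (\<bar>x\<bar> powr (- a)) * exp (\<i> * of_real (sgn x * (pi * a / 2)))"
  proof -
    have "Ln (- (\<i> * of_real x)) = of_real (ln \<bar>x\<bar>) - \<i> * of_real (sgn x * (pi / 2))"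
    proof (rule Ln_unique)
      have "exp (complex_of_real (ln \<bar>x\<bar>) - \<i> * complex_of_real (sgn x * (pi / 2))) =
         of_real \<bar>x\<bar> * exp (- (\<i> * complex_of_real (sgn x * (pi / 2))))"
        using assms exp_add[of "complex_of_real (ln \<bar>x\<bar>)" "- (\<i> * complex_of_real (sgn x * (pi / 2)))"]
        by (simp add: exp_of_real del: of_real_mult)
      also have "\<dots> = - (\<i> * of_real x)"
        using assms by (cases "0 < x") (auto simp: sgn_if exp_minus_Euler exp_Euler cos_of_real sin_of_real complex_eq_iff Re_exp Im_exp)
      finally show "exp (complex_of_real (ln \<bar>x\<bar>) - \<i> * complex_of_real (sgn x * (pi / 2))) = - (\<i> * of_real x)" .
    next
      have "- (pi / 2) \<le> pi" using pi_gt_zero by linarith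
      then show "Im (complex_of_real (ln \<bar>x\<bar>) - \<i> * complex_of_real (sgn x * (pi / 2))) \<le> pi"
        by (auto simp: sgn_if)
    qed (use pi_gt_zero in \<open>auto simp: sgn_if\<close>)
    note L = this
    have "(- (\<i> * of_real x)) powr (- of_real a) = exp (- of_real a * Ln (- (\<i> * of_real x)))"
      using assms by (simp add: powr_def)
    also have "\<dots> = exp (complex_of_real (- a * ln \<bar>x\<bar>) + \<i> * of_real (sgn x * (pi * a / 2)))"
      unfolding L by (intro arg_cong[of _ _ exp]) (simp add: algebra_simps)
    also have "\<dots> = of_real (\<bar>x\<bar> powr (- a)) * exp (\<i> * of_real (sgn x * (pi * a / 2)))"
      unfolding exp_add exp_of_real using assms by (simp add: powr_def)
    finally show ?thesis .
  qed
  moreover have "(\<lambda>n. (of_real (1 / real (Suc n)) - \<i> * of_real x) powr (- of_real a)) \<longlonglongrightarrow> (of_real 0 - \<i> * of_real x) powr (- of_real a)"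
  proof (intro tendsto_powr_complex tendsto_intros)
    show "(\<lambda>n. 1 / real (Suc n)) \<longlonglongrightarrow> 0" using LIMSEQ_inverse_real_of_nat by (simp add: inverse_eq_divide)
    show "of_real 0 - \<i> * of_real x \<notin> \<real>\<^sub>\<le>\<^sub>0" using assms by (auto simp: complex_nonpos_Reals_iff)
  qed
  ultimately show ?thesis by simp
qed

lemma kernel_bound:
  assumes "0 < a" "0 < e" "x \<noteq> 0"
  shows "cmod ((of_real e - \<i> * of_real x) powr (- of_real a)) \<le> \<bar>x\<bar> powr (- a)"
proof -
  have ne: "complex_of_real e - \<i> * of_real x \<noteq> 0" using assms by (auto simp: complex_eq_iff)
  have "cmod ((of_real e - \<i> * of_real x) powr (- of_real a)) = cmod (of_real e - \<i> * of_real x) powr (- a)"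
    using ne by (subst norm_powr_real_powr') (auto)
  also have "\<dots> \<le> \<bar>x\<bar> powr (- a)"
  proof (rule powr_mono2')
    show "\<bar>x\<bar> \<le> cmod (of_real e - \<i> * of_real x)"
      using abs_Im_le_cmod[of "of_real e - \<i> * of_real x"] by simp
  qed (use assms in auto)
  finally show ?thesis .
qed

text \<open>As \<open>\<epsilon> \<rightarrow> 0\<close> the regularized kernel tends to \<open>exp(\<i> \<pi> a / 2) x\<^sup>-\<^sup>a\<close> for \<open>x > 0\<close> and to its
  conjugate reflection for \<open>x < 0\<close>; the two halves contribute conjugate values to the form.\<close>

proposition rotated_kernel_positive:
  fixes w :: "real \<Rightarrow> complex"
  assumes a: "0 < a" "a < 1" and T: "0 \<le> T" and wm[measurable]: "w \<in> borel_measurable borel"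
    and wb: "\<And>t. cmod (w t) \<le> C" and w0: "\<And>t. t \<notin> {0..T} \<Longrightarrow> w t = 0"
  shows "0 \<le> Re (exp (\<i> * of_real (pi * a / 2)) *
     (\<integral>t. cnj (w t) * (\<integral>s. of_real (trunc_powr (- a) T (t - s)) * w s \<partial>lborel) \<partial>lborel))"
proof -
  have C: "0 \<le> C" using wb[of 0] norm_ge_zero order_trans by blast
  have indT: "integrable lborel (\<lambda>t. indicator {0..T} t *\<^sub>R K)" for K :: complex
    using T by (intro integrable_scaleR_left integrable_real_indicator) auto
  have w: "integrable lborel w"
    using indT[of "of_real C"] by (rule Bochner_Integration.integrable_bound)
      (use wb w0 C in \<open>auto simp: indicator_def intro: order_trans\<close>)
  have [measurable]: "(\<lambda>t. cnj (w t)) \<in> borel_measurable borel"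
    by (rule measurable_compose[OF wm borel_measurable_continuous_onI]) (intro continuous_intros)
  define q :: "real \<Rightarrow> complex" where "q x = of_real (trunc_powr (- a) T x)" for x
  have qm[measurable]: "q \<in> borel_measurable borel" by (simp add: q_def[abs_def])
  have q: "integrable lborel q"
    unfolding q_def using trunc_powr_integrable[of "- a" T] a T by simp
  have q': "integrable lborel (\<lambda>x. q (- x))"
    using lborel_integrable_real_affine[OF q, of "-1" 0] by simp
  define k where "k n x = (of_real (1 / real (Suc n)) - \<i> * of_real x) powr (- of_real a)" for n and x :: real
  have [measurable]: "k n \<in> borel_measurable borel" for n
    unfolding k_def by measurable
  define \<theta> where "\<theta> = exp (\<i> * of_real (pi * a / 2))"
  define k0 where "k0 x = \<theta> * q x + cnj \<theta> * q (- x)" for x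
  have k0: "integrable lborel k0" unfolding k0_def using q q' by simp
  have [measurable]: "k0 \<in> borel_measurable borel" using k0 by auto
  define m where "m x = cmod (q x) + cmod (q (- x))" for x
  have m: "integrable lborel m" unfolding m_def using q q' by simp
  have mt: "integrable lborel (\<lambda>s. m (t - s))" for t
    using lborel_integrable_real_affine[OF m, of "-1" t] by simp
  have mt_int: "(\<integral>s. m (t - s) \<partial>lborel) = (\<integral>s. m s \<partial>lborel)" for t
    using lborel_integral_real_affine[of "-1" m t] by simp
  have klim: "(\<lambda>n. k n x) \<longlonglongrightarrow> k0 x" if "x \<noteq> 0" "\<bar>x\<bar> \<le> T" for x
  proof -
    have "of_real (\<bar>x\<bar> powr (- a)) * exp (\<i> * of_real (sgn x * (pi * a / 2))) = k0 x"
      using that by (auto simp: k0_def \<theta>_def q_def trunc_powr_def sgn_if exp_cnj)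
    then show ?thesis using kernel_limit[OF that(1) a(1)] by (simp add: k_def)
  qed
  have kb: "cmod (k n x) \<le> m x" if "x \<noteq> 0" "\<bar>x\<bar> \<le> T" for n x
    using kernel_bound[OF a(1) _ that(1), of "1 / real (Suc n)"] that
    by (auto simp: k_def m_def q_def trunc_powr_def)
  have AEt: "AE s in lborel. s \<noteq> t" for t :: real by (rule AE_lborel_singleton)
  have kmw: "cmod (w s * k n (t - s)) \<le> C * m (t - s)" if "t \<in> {0..T}" "s \<noteq> t" for s t n
  proof (cases "s \<in> {0..T}")
    case True
    then show ?thesis using that kb[of "t - s" n] wb[of s] C by (auto simp: norm_mult intro!: mult_mono)
  next
    case False
    then show ?thesis using w0 C by (simp add: m_def)
  qed
  have inner: "(\<lambda>n. \<integral>s. w s * k n (t - s) \<partial>lborel) \<longlonglongrightarrow> (\<integral>s. w s * k0 (t - s) \<partial>lborel)" if t: "t \<in> {0..T}" for t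
  proof (rule integral_dominated_convergence)
    show "integrable lborel (\<lambda>s. C * m (t - s))" using mt by simp
    show "AE s in lborel. (\<lambda>n. w s * k n (t - s)) \<longlonglongrightarrow> w s * k0 (t - s)"
      using AEt[of t]
    proof eventually_elim
      case (elim s)
      show ?case
      proof (cases "s \<in> {0..T}")
        case True
        then show ?thesis using elim t by (intro tendsto_mult_left klim) auto
      qed (use w0 in simp)
    qed
    show "AE s in lborel. norm (w s * k n (t - s)) \<le> C * m (t - s)" for n
      using AEt[of t] by eventually_elim (use kmw[OF t] in auto)
  qed measurable
  have inner_b: "cmod (\<integral>s. w s * k n (t - s) \<partial>lborel) \<le> C * (\<integral>s. m s \<partial>lborel)" if t: "t \<in> {0..T}" for t n
  proof -
    have "cmod (\<integral>s. w s * k n (t - s) \<partial>lborel) \<le> (\<integral>s. C * m (t - s) \<partial>lborel)"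
    proof (rule order_trans[OF integral_norm_bound])
      have ae: "AE s in lborel. norm (w s * k n (t - s)) \<le> C * m (t - s)"
        using AEt[of t] by eventually_elim (use kmw[OF t] in auto)
      have int: "integrable lborel (\<lambda>s. w s * k n (t - s))"
      proof (rule Bochner_Integration.integrable_bound[where f="\<lambda>s. C * m (t - s)"])
        show "AE s in lborel. norm (w s * k n (t - s)) \<le> norm (C * m (t - s))"
          using ae by eventually_elim (auto intro: order_trans)
      qed (use mt in auto)
      show "(\<integral>s. cmod (w s * k n (t - s)) \<partial>lborel) \<le> (\<integral>s. C * m (t - s) \<partial>lborel)"
        using ae by (intro integral_mono_AE integrable_norm[OF int]) (use mt in auto)
    qed
    then show ?thesis by (simp add: mt_int)
  qed
  have outer: "(\<lambda>n. \<integral>t. cnj (w t) * (\<integral>s. w s * k n (t - s) \<partial>lborel) \<partial>lborel) \<longlonglongrightarrow>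
      (\<integral>t. cnj (w t) * (\<integral>s. w s * k0 (t - s) \<partial>lborel) \<partial>lborel)"
  proof (rule integral_dominated_convergence)
    show "integrable lborel (\<lambda>t. cmod (w t) * (C * (\<integral>s. m s \<partial>lborel)))" using w by auto
    show "AE t in lborel. (\<lambda>n. cnj (w t) * (\<integral>s. w s * k n (t - s) \<partial>lborel)) \<longlonglongrightarrow> cnj (w t) * (\<integral>s. w s * k0 (t - s) \<partial>lborel)"
    proof (rule AE_I2)
      fix t show "(\<lambda>n. cnj (w t) * (\<integral>s. w s * k n (t - s) \<partial>lborel)) \<longlonglongrightarrow> cnj (w t) * (\<integral>s. w s * k0 (t - s) \<partial>lborel)"
        by (cases "t \<in> {0..T}") (auto intro!: tendsto_mult_left inner simp: w0)
    qed
    show "AE t in lborel. norm (cnj (w t) * (\<integral>s. w s * k n (t - s) \<partial>lborel)) \<le> cmod (w t) * (C * (\<integral>s. m s \<partial>lborel))" for n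
    proof (rule AE_I2)
      fix t show "norm (cnj (w t) * (\<integral>s. w s * k n (t - s) \<partial>lborel)) \<le> cmod (w t) * (C * (\<integral>s. m s \<partial>lborel))"
        by (cases "t \<in> {0..T}") (auto simp: norm_mult w0 intro!: mult_left_mono inner_b)
    qed
  qed measurable
  have lim_ge: "0 \<le> Re (\<integral>t. cnj (w t) * (\<integral>s. w s * k0 (t - s) \<partial>lborel) \<partial>lborel)"
  proof (rule LIMSEQ_le_const[OF tendsto_Re[OF outer]], intro exI allI impI)
    show "0 \<le> Re (\<integral>t. cnj (w t) * (\<integral>s. w s * k n (t - s) \<partial>lborel) \<partial>lborel)" for n
      unfolding k_def by (rule regularized_kernel_positive[OF a(1) _ w]) simp
  qed
  define A where "A = (\<integral>t. cnj (w t) * (\<integral>s. q (t - s) * w s \<partial>lborel) \<partial>lborel)"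
  have bd: "integrable lborel (\<lambda>s. g (t - s) * w s)" if g: "integrable lborel g" for g :: "real \<Rightarrow> complex" and t
  proof (rule Bochner_Integration.integrable_bound[where f="\<lambda>s. of_real C * g (t - s)"])
    show "integrable lborel (\<lambda>s. of_real C * g (t - s))"
      using lborel_integrable_real_affine[OF g, of "-1" t] by simp
    have "g \<in> borel_measurable borel" using g by auto
    then show "(\<lambda>s. g (t - s) * w s) \<in> borel_measurable lborel" by measurable
    show "AE s in lborel. norm (g (t - s) * w s) \<le> norm (of_real C * g (t - s))"
      using wb C by (intro AE_I2) (simp add: norm_mult mult.commute mult_right_mono)
  qed
  have conv_b: "integrable lborel (\<lambda>t. cnj (w t) * (\<integral>s. g (t - s) * w s \<partial>lborel))" if g: "integrable lborel g" for g :: "real \<Rightarrow> complex"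
  proof -
    have "integrable (lborel \<Otimes>\<^sub>M lborel) (\<lambda>(y, x). cnj (w x) * g (x - y) * w y)"
      by (rule convolution_kernel_integrable[OF _ _ w g, of _ C]) (use wb in auto)
    from lborel_pair.integrable_snd[OF this]
    show ?thesis by (simp add: mult.assoc)
  qed
  have B: "(\<integral>t. cnj (w t) * (\<integral>s. q (- (t - s)) * w s \<partial>lborel) \<partial>lborel) = cnj A"
  proof -
    have "(\<integral>t. cnj (w t) * (\<integral>s. q (- (t - s)) * w s \<partial>lborel) \<partial>lborel) =
       (\<integral>s. w s * (\<integral>t. cnj (w t) * q (- (t - s)) \<partial>lborel) \<partial>lborel)"
      by (rule Fubini_convolution[OF _ _ w q', of _ C]) (use wb in auto)
    also have "\<dots> = (\<integral>s. cnj (cnj (w s) * (\<integral>t. q (s - t) * w t \<partial>lborel)) \<partial>lborel)"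
      by (simp add: Bochner_Integration.integral_cnj[symmetric] q_def mult.commute del: Bochner_Integration.integral_cnj)
    also have "\<dots> = cnj A" unfolding A_def by (simp only: Bochner_Integration.integral_cnj)
    finally show ?thesis .
  qed
  have "(\<integral>t. cnj (w t) * (\<integral>s. w s * k0 (t - s) \<partial>lborel) \<partial>lborel) =
     (\<integral>t. \<theta> * (cnj (w t) * (\<integral>s. q (t - s) * w s \<partial>lborel)) + cnj \<theta> * (cnj (w t) * (\<integral>s. q (- (t - s)) * w s \<partial>lborel)) \<partial>lborel)"
  proof (rule Bochner_Integration.integral_cong)
    fix t
    have "(\<integral>s. w s * k0 (t - s) \<partial>lborel) = (\<integral>s. \<theta> * (q (t - s) * w s) + cnj \<theta> * (q (- (t - s)) * w s) \<partial>lborel)"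
      by (intro Bochner_Integration.integral_cong) (auto simp: k0_def algebra_simps)
    also have "\<dots> = \<theta> * (\<integral>s. q (t - s) * w s \<partial>lborel) + cnj \<theta> * (\<integral>s. q (- (t - s)) * w s \<partial>lborel)"
      using bd[OF q, of t] bd[OF q', of t] by (simp del: minus_diff_eq)
    finally show "cnj (w t) * (\<integral>s. w s * k0 (t - s) \<partial>lborel) =
      \<theta> * (cnj (w t) * (\<integral>s. q (t - s) * w s \<partial>lborel)) + cnj \<theta> * (cnj (w t) * (\<integral>s. q (- (t - s)) * w s \<partial>lborel))"
      by (simp only: ring_distribs mult.left_commute)
  qed simp
  also have "\<dots> = \<theta> * A + cnj \<theta> * cnj A"
    using conv_b[OF q] conv_b[OF q'] B by (simp add: A_def del: minus_diff_eq)
  finally have "0 \<le> Re (\<theta> * A + cnj (\<theta> * A))" using lim_ge by simp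
  then show ?thesis by (simp add: \<theta>_def A_def q_def)
qed

section \<open>The energy estimate\<close>

lemma trunc_powr_bounded_integrable:
  fixes w :: "real \<Rightarrow> complex"
  assumes "-1 < b" "0 \<le> T" and [measurable]: "w \<in> borel_measurable borel" and wb: "\<And>t. cmod (w t) \<le> C"
  shows "integrable lborel (\<lambda>s. of_real (trunc_powr b T (t - s)) * w s)"
proof (rule Bochner_Integration.integrable_bound[where f="\<lambda>s. C * trunc_powr b T (t - s)"])
  show "integrable lborel (\<lambda>s. C * trunc_powr b T (t - s))"
    using lborel_integrable_real_affine[OF trunc_powr_integrable[OF assms(1,2)], of "-1" t] by simp
  show "AE s in lborel. norm (of_real (trunc_powr b T (t - s)) * w s) \<le> norm (C * trunc_powr b T (t - s))"
  proof (rule AE_I2)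
    fix s
    have "cmod (w s) \<le> \<bar>C\<bar>" using wb[of s] by linarith
    then show "norm (of_real (trunc_powr b T (t - s)) * w s) \<le> norm (C * trunc_powr b T (t - s))"
      by (simp add: norm_mult abs_mult mult.commute mult_right_mono)
  qed
qed measurable

lemma integral_approx_linear:
  fixes f :: "real \<Rightarrow> complex"
  assumes "a \<le> b" "continuous_on {a..b} f" "\<And>s. s \<in> {a..b} \<Longrightarrow> cmod (f s - c) \<le> \<eta>"
  shows "cmod (integral {a..b} f - of_real (b - a) * c) \<le> \<eta> * (b - a)"
proof -
  have f: "f integrable_on {a..b}" using assms(2) by (rule integrable_continuous_real)
  have "integral {a..b} f - of_real (b - a) * c = integral {a..b} (\<lambda>s. f s - c)"
    using integral_unique[OF has_integral_diff[OF integrable_integral[OF f] has_integral_const_real[of c a b]]] assms(1)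
    by (simp add: scaleR_conv_of_real)
  also have "cmod \<dots> \<le> \<eta> * (b - a)"
    using assms by (intro integral_bound continuous_intros) auto
  finally show ?thesis .
qed

text \<open>The positivity is applied to the increment \<open>w(t) = e(t) - e(t - \<delta>)\<close> of \<open>e = f - f(0)\<close>, which
  vanishes for \<open>t \<le> 0\<close>: its convolution is the increment \<open>G\<close> of \<open>F = \<integral> f\<close>, and \<open>w = G'\<close> except on
  \<open>[0, \<delta>]\<close>, where \<open>w = G' - f(0)\<close>. Dividing by \<open>\<delta>\<^sup>2\<close> and letting \<open>\<delta> \<rightarrow> 0\<close> avoids any
  integrability assumption on \<open>f'\<close> against the singular kernel.\<close>

proposition energy_estimate:
  fixes f :: "real \<Rightarrow> complex"
  assumes a: "0 < a" "a < 1" and T: "0 < T" and L: "0 < L" and fc: "continuous_on {0..T} f"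
    and eq: "\<And>t. t \<in> {0..T} \<Longrightarrow> exp (\<i> * of_real (pi * a / 2)) *
      (\<integral>s. of_real (trunc_powr (- a) T (t - s)) * (indicator {0..T} s *\<^sub>R (f s - f 0)) \<partial>lborel) = of_real L * integral {0..t} f"
  shows "cmod (f 0) \<le> cmod (f T)"
proof -
  define \<theta> where "\<theta> = exp (\<i> * of_real (pi * a / 2))"
  define c where "c = f 0"
  define g where "g t = f (min T (max 0 t))" for t
  have gc: "continuous_on UNIV g"
    unfolding g_def by (rule continuous_on_compose2[OF fc]) (use T in \<open>auto intro!: continuous_intros\<close>)
  have gcS: "continuous_on S g" for S using continuous_on_subset[OF gc] by blast
  have [measurable]: "g \<in> borel_measurable borel" by (rule borel_measurable_continuous_onI[OF gc])
  have gf: "g t = f t" if "t \<in> {0..T}" for t using that by (auto simp: g_def min_def max_def)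
  have g0: "g t = c" if "t \<le> 0" for t using that T by (auto simp: g_def c_def min_def max_def)
  obtain B where B: "\<And>t. cmod (g t) \<le> B"
  proof -
    have "compact (f ` {0..T})" using fc by (intro compact_continuous_image) auto
    then obtain B where "\<forall>x\<in>f ` {0..T}. cmod x \<le> B" using compact_imp_bounded bounded_iff by metis
    then have "cmod (g t) \<le> B" for t using T by (auto simp: g_def)
    then show ?thesis using that by blast
  qed
  define e where "e t = g t - c" for t
  have e0: "e t = 0" if "t \<le> 0" for t using g0[OF that] by (simp add: e_def)
  have [measurable]: "e \<in> borel_measurable borel" unfolding e_def by measurable
  have ec: "continuous_on S e" for S unfolding e_def by (intro continuous_intros gcS)
  have eb: "cmod (e t) \<le> B + B" for t
    unfolding e_def using norm_triangle_ineq4[of "g t" c] B[of t] B[of 0] g0[of 0] by simp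
  define F where "F t = integral {0..t} g" for t
  have F0: "F t = 0" if "t \<le> 0" for t using that by (cases "t = 0") (auto simp: F_def)
  have Fd: "(F has_vector_derivative g t) (at t)" if "0 < t" for t
  proof -
    have "((\<lambda>u. integral {0..u} g) has_vector_derivative g t) (at t within {0..t + 1})"
      using that by (intro integral_has_vector_derivative gcS) auto
    then have "((\<lambda>u. integral {0..u} g) has_vector_derivative g t) (at t within {0<..<t + 1})"
      by (rule has_vector_derivative_within_subset) auto
    then show ?thesis unfolding F_def using that by (subst (asm) at_within_open) auto
  qed
  have Fc: "continuous_on UNIV F"
  proof -
    have "continuous_on {0..} F"
      unfolding continuous_on_eq_continuous_within
    proof
      fix x :: real assume "x \<in> {0..}"
      have "continuous_on {0..x + 1} F" unfolding F_def
        by (rule indefinite_integral_continuous_1[OF integrable_continuous_real[OF gcS]])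
      then have "continuous (at x within {0..x + 1}) F" using \<open>x \<in> {0..}\<close> by (auto simp: continuous_on_eq_continuous_within)
      then show "continuous (at x within {0..}) F"
        unfolding continuous_within
        by (rule Lim_transform_within_set) (auto simp: eventually_at intro!: exI[of _ 1] simp: dist_real_def)
    qed
    moreover have "continuous_on {..0} F"
      using F0 by (subst continuous_on_cong[of _ "{..0}" _ "\<lambda>_. 0"]) auto
    ultimately have "continuous_on ({..0} \<union> {0..}) F" by (intro continuous_on_closed_Un) auto
    moreover have "{..0} \<union> {0..} = (UNIV :: real set)" by auto
    ultimately show ?thesis by simp
  qed
  have FcS: "continuous_on S F" for S using continuous_on_subset[OF Fc] by blast
  define cv where "cv t = (\<integral>s. of_real (trunc_powr (- a) T (t - s)) * e s \<partial>lborel)" for t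
  have eint: "integrable lborel (\<lambda>s. of_real (trunc_powr (- a) T (t - s)) * e s)" for t
    using a T eb by (intro trunc_powr_bounded_integrable) auto
  have cvF: "\<theta> * cv t = of_real L * F t" if "t \<le> T" for t
  proof (cases "t \<le> 0")
    case True
    have "cv t = (\<integral>s. 0 \<partial>(lborel :: real measure))" unfolding cv_def
    proof (rule Bochner_Integration.integral_cong)
      fix s show "of_real (trunc_powr (- a) T (t - s)) * e s = 0" using True e0[of s] by (auto simp: trunc_powr_def)
    qed simp
    then show ?thesis using F0[OF True] by simp
  next
    case False
    have "cv t = (\<integral>s. of_real (trunc_powr (- a) T (t - s)) * (indicator {0..T} s *\<^sub>R (f s - f 0)) \<partial>lborel)"
      unfolding cv_def
    proof (rule Bochner_Integration.integral_cong)
      fix s show "of_real (trunc_powr (- a) T (t - s)) * e s = of_real (trunc_powr (- a) T (t - s)) * (indicator {0..T} s *\<^sub>R (f s - f 0))"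
        using that e0[of s] gf[of s] by (auto simp: trunc_powr_def indicator_def e_def c_def)
    qed simp
    moreover have "F t = integral {0..t} f" unfolding F_def using that gf by (intro integral_cong) auto
    ultimately show ?thesis using eq[of t] that False by (simp add: \<theta>_def)
  qed
  have key: "2 * Re (cnj c * integral {0..\<delta>} F) \<le> (cmod (integral {T - \<delta>..T} g))\<^sup>2" if \<delta>: "0 < \<delta>" "\<delta> < T" for \<delta>
  proof -
    define w where "w t = indicator {0..T} t *\<^sub>R (e t - e (t - \<delta>))" for t
    define G where "G t = F t - F (t - \<delta>)" for t
    have wT: "w t = e t - e (t - \<delta>)" if "t \<in> {0..T}" for t using that by (simp add: w_def)
    have [measurable]: "w \<in> borel_measurable borel" unfolding w_def by measurable
    have e2b: "cmod (e t - e (t - \<delta>)) \<le> 4 * B" for t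
      using norm_triangle_ineq4[of "e t" "e (t - \<delta>)"] eb[of t] eb[of "t - \<delta>"] by simp
    have "0 \<le> B" using B[of 0] norm_ge_zero order_trans by blast
    then have wb: "cmod (w t) \<le> 4 * B" for t using e2b[of t] by (simp add: w_def indicator_def)
    have cw: "\<theta> * (\<integral>s. of_real (trunc_powr (- a) T (t - s)) * w s \<partial>lborel) = of_real L * G t" if t: "t \<in> {0..T}" for t
    proof -
      have "(\<integral>s. of_real (trunc_powr (- a) T (t - s)) * w s \<partial>lborel) =
          (\<integral>s. of_real (trunc_powr (- a) T (t - s)) * e s - of_real (trunc_powr (- a) T (t - s)) * e (s - \<delta>) \<partial>lborel)"
      proof (rule Bochner_Integration.integral_cong)
        fix s show "of_real (trunc_powr (- a) T (t - s)) * w s = of_real (trunc_powr (- a) T (t - s)) * e s - of_real (trunc_powr (- a) T (t - s)) * e (s - \<delta>)"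
          using t e0[of s] e0[of "s - \<delta>"] \<delta> by (auto simp: trunc_powr_def w_def indicator_def algebra_simps)
      qed simp
      also have "\<dots> = cv t - (\<integral>s. of_real (trunc_powr (- a) T (t - s)) * e (s - \<delta>) \<partial>lborel)"
        unfolding cv_def using a T eb
        by (intro Bochner_Integration.integral_diff eint trunc_powr_bounded_integrable) auto
      also have "(\<integral>s. of_real (trunc_powr (- a) T (t - s)) * e (s - \<delta>) \<partial>lborel) = cv (t - \<delta>)"
        unfolding cv_def using lborel_integral_real_affine[of 1 "\<lambda>s. of_real (trunc_powr (- a) T (t - s)) * e (s - \<delta>)" \<delta>]
        by (simp add: algebra_simps)
      finally have "\<theta> * (\<integral>s. of_real (trunc_powr (- a) T (t - s)) * w s \<partial>lborel) = \<theta> * cv t - \<theta> * cv (t - \<delta>)"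
        by (simp only: right_diff_distrib)
      then show ?thesis using cvF[of t] cvF[of "t - \<delta>"] t \<delta> by (simp add: G_def right_diff_distrib)
    qed
    have Gc: "continuous_on S G" for S
      unfolding G_def by (intro continuous_intros continuous_on_compose2[OF Fc]) auto
    have "0 \<le> Re (\<theta> * (\<integral>t. cnj (w t) * (\<integral>s. of_real (trunc_powr (- a) T (t - s)) * w s \<partial>lborel) \<partial>lborel))"
      unfolding \<theta>_def using a T wb by (intro rotated_kernel_positive[of _ _ _ "4 * B"]) (auto simp: w_def)
    also have "\<theta> * (\<integral>t. cnj (w t) * (\<integral>s. of_real (trunc_powr (- a) T (t - s)) * w s \<partial>lborel) \<partial>lborel)
      = (\<integral>t. cnj (w t) * (\<theta> * (\<integral>s. of_real (trunc_powr (- a) T (t - s)) * w s \<partial>lborel)) \<partial>lborel)"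
      by (simp only: integral_mult_right_zero[symmetric] mult.left_commute)
    also have "\<dots> = (\<integral>t. of_real L * (indicator {0..T} t *\<^sub>R (cnj (e t - e (t - \<delta>)) * G t)) \<partial>lborel)"
    proof (rule Bochner_Integration.integral_cong)
      fix t show "cnj (w t) * (\<theta> * (\<integral>s. of_real (trunc_powr (- a) T (t - s)) * w s \<partial>lborel)) =
         of_real L * (indicator {0..T} t *\<^sub>R (cnj (e t - e (t - \<delta>)) * G t))"
        by (cases "t \<in> {0..T}") (simp_all add: cw wT mult.left_commute, simp add: w_def)
    qed simp
    also have "\<dots> = of_real L * (LBINT t:{0..T}. cnj (e t - e (t - \<delta>)) * G t)"
      by (simp only: set_lebesgue_integral_def integral_mult_right_zero)
    also have "(LBINT t:{0..T}. cnj (e t - e (t - \<delta>)) * G t) = integral {0..T} (\<lambda>t. cnj (e t - e (t - \<delta>)) * G t)"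
      by (intro set_borel_integral_eq_integral(2) borel_integrable_atLeastAtMost' continuous_intros Gc ec
          continuous_on_compose2[OF ec[of UNIV]]) auto
    finally have pos: "0 \<le> Re (integral {0..T} (\<lambda>t. cnj (e t - e (t - \<delta>)) * G t))"
      using L by (simp add: zero_le_mult_iff)
    define p where "p t = Re (cnj (e t - e (t - \<delta>)) * G t)" for t
    have pint: "p integrable_on {0..T}" "0 \<le> integral {0..T} p"
    proof -
      have c: "continuous_on {0..T} (\<lambda>t. cnj (e t - e (t - \<delta>)) * G t)"
        by (intro continuous_intros Gc ec continuous_on_compose2[OF ec[of UNIV]]) auto
      note i = integrable_integral[OF integrable_continuous_real[OF c]]
      have "(p has_integral Re (integral {0..T} (\<lambda>t. cnj (e t - e (t - \<delta>)) * G t))) {0..T}"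
        unfolding p_def using has_integral_linear[OF i bounded_linear_Re] by (simp add: o_def)
      then show "p integrable_on {0..T}" "0 \<le> integral {0..T} p"
        using pos by (auto simp: integral_unique has_integral_integrable)
    qed
    define H where "H t = (cmod (G t))\<^sup>2 / 2" for t
    have H_eq: "H t = (Re (G t) * Re (G t) + Im (G t) * Im (G t)) / 2" for t
      using cmod_power2[of "G t"] by (simp add: H_def power2_eq_square)
    define r where "r t = Re (cnj c * F t)" for t
    define h where "h t = p t + (if t \<in> {0..\<delta>} then r t else 0)" for t
    have "(h has_integral (H T - H 0)) {0..T}"
    proof (rule fundamental_theorem_of_calculus_interior_strong[of "{\<delta>}"])
      fix t assume t: "t \<in> {0<..<T} - {\<delta>}"
      define G' where "G' = g t - (if t < \<delta> then 0 else g (t - \<delta>))"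
      have "((\<lambda>t. F (t - \<delta>)) has_vector_derivative (if t < \<delta> then 0 else g (t - \<delta>))) (at t)"
      proof (cases "t < \<delta>")
        case True
        have "((\<lambda>t. 0) has_vector_derivative (0::complex)) (at t)" by simp
        then have "((\<lambda>t. F (t - \<delta>)) has_vector_derivative 0) (at t)"
          by (rule has_vector_derivative_transform_within_open[of _ _ _ "{..<\<delta>}"]) (use True F0 in auto)
        then show ?thesis using True by simp
      next
        case False
        have "((F \<circ> (\<lambda>t. t - \<delta>)) has_vector_derivative 1 *\<^sub>R g (t - \<delta>)) (at t)"
          using False t by (intro vector_diff_chain_at Fd) (auto intro!: derivative_eq_intros)
        then show ?thesis using False by (simp add: o_def)
      qed
      then have Gd: "(G has_vector_derivative G') (at t)"
        unfolding G_def G'_def using Fd[of t] t by (intro has_vector_derivative_diff) auto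
      have Rd: "((\<lambda>t. Re (G t)) has_real_derivative Re G') (at t)" "((\<lambda>t. Im (G t)) has_real_derivative Im G') (at t)"
        using bounded_linear.has_vector_derivative[OF bounded_linear_Re Gd] bounded_linear.has_vector_derivative[OF bounded_linear_Im Gd]
        by (simp_all add: has_real_derivative_iff_has_vector_derivative)
      have "(H has_real_derivative (Re (G t) * Re G' + Im (G t) * Im G')) (at t)"
        unfolding H_eq
        by (rule DERIV_cong[OF DERIV_cdivide[OF DERIV_add[OF DERIV_mult[OF Rd(1) Rd(1)] DERIV_mult[OF Rd(2) Rd(2)]]]])
          (simp add: field_simps)
      moreover have "Re (G t) * Re G' + Im (G t) * Im G' = h t"
      proof (cases "t < \<delta>")
        case True
        then have "e (t - \<delta>) = 0" "F (t - \<delta>) = 0" using e0 F0 by auto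
        then show ?thesis using True t by (simp add: h_def p_def r_def G'_def G_def e_def algebra_simps)
      next
        case False
        then show ?thesis using t by (simp add: h_def p_def G'_def e_def algebra_simps)
      qed
      ultimately show "(H has_vector_derivative h t) (at t)"
        by (simp add: has_real_derivative_iff_has_vector_derivative)
    next
      show "continuous_on {0..T} H" unfolding H_def by (intro continuous_intros Gc) auto
    qed (use T in auto)
    moreover have "G 0 = 0" using F0 \<delta> by (simp add: G_def)
    ultimately have hI: "(h has_integral H T) {0..T}" by (simp add: H_def)
    have rI: "(r has_integral Re (cnj c * integral {0..\<delta>} F)) {0..\<delta>}"
    proof -
      have "((\<lambda>t. cnj c * F t) has_integral (cnj c * integral {0..\<delta>} F)) {0..\<delta>}"
        by (intro has_integral_mult_right integrable_integral integrable_continuous_real FcS)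
      from has_integral_linear[OF this bounded_linear_Re] show ?thesis by (simp add: o_def r_def[abs_def])
    qed
    have "((\<lambda>t. if t \<in> {0..\<delta>} then r t else 0) has_integral Re (cnj c * integral {0..\<delta>} F)) {0..T}"
      using rI \<delta> by (subst has_integral_restrict) auto
    from has_integral_add[OF integrable_integral[OF pint(1)] this]
    have "(h has_integral (integral {0..T} p + Re (cnj c * integral {0..\<delta>} F))) {0..T}"
      by (simp only: h_def[abs_def])
    then have "H T = integral {0..T} p + Re (cnj c * integral {0..\<delta>} F)" using hI has_integral_unique by blast
    then have "Re (cnj c * integral {0..\<delta>} F) \<le> H T" using pint(2) by simp
    moreover have "G T = integral {T - \<delta>..T} g"
    proof -
      have "integral {0..T - \<delta>} g + integral {T - \<delta>..T} g = integral {0..T} g"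
        using \<delta> by (intro Henstock_Kurzweil_Integration.integral_combine integrable_continuous_real gcS) auto
      then show ?thesis by (simp add: G_def F_def algebra_simps)
    qed
    ultimately show ?thesis by (simp add: H_def)
  qed
  have limit: "(cmod c)\<^sup>2 - cmod c * \<eta> \<le> (cmod (f T) + \<eta>)\<^sup>2" if \<eta>: "0 < \<eta>" for \<eta>
  proof -
    have "isCont g 0" "isCont g T" using gc by (auto simp: continuous_on_eq_continuous_at)
    then obtain d1 d2 where d: "0 < d1" "\<And>x. dist x 0 < d1 \<Longrightarrow> dist (g x) (g 0) < \<eta>"
      "0 < d2" "\<And>x. dist x T < d2 \<Longrightarrow> dist (g x) (g T) < \<eta>"
      using \<eta> unfolding continuous_at_eps_delta by metis
    define \<delta> where "\<delta> = min (min d1 d2) T / 2"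
    have \<delta>: "0 < \<delta>" "\<delta> < T" "\<delta> < d1" "\<delta> < d2" using d T by (auto simp: \<delta>_def)
    have near0: "cmod (g s - c) \<le> \<eta>" if "s \<in> {0..\<delta>}" for s
      using d(2)[of s] that \<delta> g0[of 0] by (auto simp: dist_norm)
    have nearT: "cmod (g s - g T) \<le> \<eta>" if "s \<in> {T - \<delta>..T}" for s
      using d(4)[of s] that \<delta> by (auto simp: dist_norm)
    have F1: "cmod (F t - of_real t * c) \<le> \<eta> * t" if "t \<in> {0..\<delta>}" for t
      using integral_approx_linear[of 0 t g c \<eta>] near0 that gcS by (auto simp: F_def)
    have int_id: "((\<lambda>t. t) has_integral \<delta>\<^sup>2 / 2) {0..\<delta>}"
      using ident_has_integral[of 0 \<delta>] \<delta> by simp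
    have Fi: "F integrable_on {0..\<delta>}" by (intro integrable_continuous_real FcS)
    have "cmod (integral {0..\<delta>} (\<lambda>t. F t - of_real t * c)) \<le> integral {0..\<delta>} (\<lambda>t. \<eta> * t)"
      using F1 by (intro integral_norm_bound_integral integrable_continuous_real continuous_intros FcS) auto
    also have "integral {0..\<delta>} (\<lambda>t. \<eta> * t) = \<eta> * (\<delta>\<^sup>2 / 2)" using int_id by (simp add: integral_unique)
    also have "integral {0..\<delta>} (\<lambda>t. F t - of_real t * c) = integral {0..\<delta>} F - of_real (\<delta>\<^sup>2 / 2) * c"
    proof -
      have "((\<lambda>t. of_real t * c) has_integral (of_real (\<delta>\<^sup>2 / 2) * c)) {0..\<delta>}"
        using has_integral_of_real[OF int_id] by (rule has_integral_mult_left)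
      then show ?thesis by (intro integral_unique has_integral_diff integrable_integral Fi)
    qed
    finally have FI: "cmod (integral {0..\<delta>} F - of_real (\<delta>\<^sup>2 / 2) * c) \<le> \<eta> * (\<delta>\<^sup>2 / 2)" .
    define z where "z = integral {0..\<delta>} F - of_real (\<delta>\<^sup>2 / 2) * c"
    have "Re (cnj c * integral {0..\<delta>} F) = (cmod c)\<^sup>2 * (\<delta>\<^sup>2 / 2) + Re (cnj c * z)"
    proof -
      have "cnj c * integral {0..\<delta>} F = of_real (\<delta>\<^sup>2 / 2) * (c * cnj c) + cnj c * z"
        by (simp add: z_def algebra_simps)
      also have "of_real (\<delta>\<^sup>2 / 2) * (c * cnj c) = complex_of_real ((cmod c)\<^sup>2 * (\<delta>\<^sup>2 / 2))"
        by (simp only: complex_norm_square[symmetric] of_real_mult mult.commute)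
      finally show ?thesis by simp
    qed
    moreover have "- (cmod c * (\<eta> * (\<delta>\<^sup>2 / 2))) \<le> Re (cnj c * z)"
    proof -
      have "\<bar>Re (cnj c * z)\<bar> \<le> cmod c * cmod z" using abs_Re_le_cmod[of "cnj c * z"] by (simp add: norm_mult)
      also have "\<dots> \<le> cmod c * (\<eta> * (\<delta>\<^sup>2 / 2))" using FI by (intro mult_left_mono) (auto simp: z_def)
      finally show ?thesis by linarith
    qed
    ultimately have lower: "\<delta>\<^sup>2 * ((cmod c)\<^sup>2 - cmod c * \<eta>) \<le> 2 * Re (cnj c * integral {0..\<delta>} F)"
      by (simp add: algebra_simps)
    have "cmod (integral {T - \<delta>..T} g) \<le> (cmod (f T) + \<eta>) * (T - (T - \<delta>))"
    proof (rule integral_bound)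
      fix s assume "s \<in> {T - \<delta>..T}"
      then show "cmod (g s) \<le> cmod (f T) + \<eta>"
        using nearT[of s] norm_triangle_ineq[of "g T" "g s - g T"] gf[of T] T by simp
    qed (use \<delta> gcS in auto)
    then have "(cmod (integral {T - \<delta>..T} g))\<^sup>2 \<le> \<delta>\<^sup>2 * (cmod (f T) + \<eta>)\<^sup>2"
      using power_mono[of "cmod (integral {T - \<delta>..T} g)" "(cmod (f T) + \<eta>) * \<delta>" 2] by (simp add: power_mult_distrib mult.commute)
    with lower key[OF \<delta>(1,2)] have "\<delta>\<^sup>2 * ((cmod c)\<^sup>2 - cmod c * \<eta>) \<le> \<delta>\<^sup>2 * (cmod (f T) + \<eta>)\<^sup>2" by linarith
    then show ?thesis using \<delta>(1) by simp
  qed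
  have "(cmod c)\<^sup>2 - cmod c * 0 \<le> (cmod (f T) + 0)\<^sup>2"
  proof (rule tendsto_le[of "at_right 0"])
    show "((\<lambda>\<eta>. (cmod c)\<^sup>2 - cmod c * \<eta>) \<longlongrightarrow> (cmod c)\<^sup>2 - cmod c * 0) (at_right 0)"
      "((\<lambda>\<eta>. (cmod (f T) + \<eta>)\<^sup>2) \<longlongrightarrow> (cmod (f T) + 0)\<^sup>2) (at_right 0)" by (intro tendsto_intros)+
    show "\<forall>\<^sub>F \<eta> in at_right 0. (cmod c)\<^sup>2 - cmod c * \<eta> \<le> (cmod (f T) + \<eta>)\<^sup>2"
      unfolding eventually_at_right_field using limit by (intro exI[of _ 1]) auto
  qed simp
  then have "(cmod c)\<^sup>2 \<le> (cmod (f T))\<^sup>2" by simp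
  then have "cmod c \<le> cmod (f T)" by (rule power2_le_imp_le) simp
  then show ?thesis by (simp only: c_def)
qed

section \<open>Uniqueness for the Volterra equation\<close>

lemma volterra_gronwall:
  fixes \<phi> :: "real \<Rightarrow> real"
  assumes a: "0 < a" and T: "0 \<le> T" and L: "0 \<le> L" and c: "continuous_on {0..T} \<phi>" and nonneg: "\<And>t. t \<in> {0..T} \<Longrightarrow> 0 \<le> \<phi> t"
    and le: "\<And>t. t \<in> {0..T} \<Longrightarrow> \<phi> t \<le> L * (\<integral>s. trunc_powr (a - 1) T (t - s) * (indicator {0..T} s *\<^sub>R \<phi> s) \<partial>lborel)"
    and t: "t \<in> {0..T}"
  shows "\<phi> t = 0"
proof -
  define M where "M = (2 * L * Gamma a + 1) powr (1 / a)"
  have Gp: "0 < Gamma a" using a by (rule Gamma_real_pos)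
  have pos: "0 < 2 * L * Gamma a + 1" proof -
    have "0 \<le> L * Gamma a" using L Gp by simp
    then show ?thesis by linarith
  qed
  have M: "0 < M" unfolding M_def using pos by (metis powr_gt_zero order_less_irrefl)
  have LM: "L * (Gamma a * M powr (- a)) \<le> 1 / 2"
  proof -
    have "M powr (- a) = 1 / (2 * L * Gamma a + 1)"
      using a pos by (simp add: M_def powr_powr powr_minus divide_inverse)
    then show ?thesis
      using pos L Gp by (simp only:) (simp add: field_simps)
  qed
  obtain x where x: "x \<in> {0..T}" "\<And>y. y \<in> {0..T} \<Longrightarrow> exp (- (M * y)) * \<phi> y \<le> exp (- (M * x)) * \<phi> x"
  proof -
    have "continuous_on {0..T} (\<lambda>y. exp (- (M * y)) * \<phi> y)" by (intro continuous_intros c)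
    from continuous_attains_sup[OF _ _ this] show ?thesis using T that by (auto simp: atLeastatMost_empty_iff)
  qed
  define m where "m = exp (- (M * x)) * \<phi> x"
  have m0: "0 \<le> m" using nonneg[OF x(1)] by (simp add: m_def)
  have \<phi>m: "\<phi> y \<le> m * exp (M * y)" if "y \<in> {0..T}" for y
    using x(2)[OF that] by (simp add: m_def exp_minus field_simps)
  let ?k = "\<lambda>r. indicator {0<..} r *\<^sub>R (r powr (a - 1) * exp (- (M * r)))"
  have ki: "integrable lborel ?k" "(\<integral>r. ?k r \<partial>lborel) = Gamma a * M powr (- a)"
    using real_gamma_kernel_integral[OF a M] by (auto simp: has_bochner_integral_iff)
  have kx: "integrable lborel (\<lambda>s. ?k (x - s))" using lborel_integrable_real_affine[OF ki(1), of "-1" x] by simp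
  have "(\<integral>s. trunc_powr (a - 1) T (x - s) * (indicator {0..T} s *\<^sub>R \<phi> s) \<partial>lborel) \<le> (\<integral>s. m * exp (M * x) * ?k (x - s) \<partial>lborel)"
  proof (rule integral_mono')
    show "integrable lborel (\<lambda>s. m * exp (M * x) * ?k (x - s))" using kx by (rule integrable_mult_right)
    fix s
    show "0 \<le> m * exp (M * x) * ?k (x - s)" using m0 by (auto simp: indicator_def)
    show "trunc_powr (a - 1) T (x - s) * (indicator {0..T} s *\<^sub>R \<phi> s) \<le> m * exp (M * x) * ?k (x - s)"
    proof (cases "s \<in> {0..T} \<and> s < x")
      case True
      then have "(x - s) powr (a - 1) * \<phi> s \<le> (x - s) powr (a - 1) * (m * exp (M * s))"
        using \<phi>m[of s] by (intro mult_left_mono) auto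
      also have "m * exp (M * s) = m * exp (M * x) * exp (- (M * (x - s)))" by (simp add: algebra_simps exp_add[symmetric])
      finally show ?thesis using True x(1) by (simp add: trunc_powr_def mult_ac)
    next
      case False
      then have "trunc_powr (a - 1) T (x - s) * (indicator {0..T} s *\<^sub>R \<phi> s) = 0" by (auto simp: trunc_powr_def indicator_def)
      moreover have "0 \<le> m * exp (M * x) * ?k (x - s)" using m0 by (auto simp: indicator_def)
      ultimately show ?thesis by (simp only:)
    qed
  qed
  also have "\<dots> = m * exp (M * x) * (Gamma a * M powr (- a))"
    using lborel_integral_real_affine[of "-1" ?k x] ki(2) by simp
  finally have "\<phi> x \<le> L * (m * exp (M * x) * (Gamma a * M powr (- a)))"
    using le[OF x(1)] L by (meson mult_left_mono order_trans)
  also have "\<dots> = (L * (Gamma a * M powr (- a))) * (m * exp (M * x))" by simp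
  also have "\<dots> \<le> 1 / 2 * (m * exp (M * x))" using LM m0 by (intro mult_right_mono) auto
  also have "m * exp (M * x) = \<phi> x" by (simp add: m_def exp_minus field_simps)
  finally have "\<phi> x \<le> 0" by simp
  then have "m \<le> 0" by (simp add: m_def mult_le_0_iff)
  then have "\<phi> t \<le> 0" using \<phi>m[OF t] by (meson exp_ge_zero mult_nonpos_nonneg order_trans)
  then show ?thesis using nonneg[OF t] by simp
qed

lemma beta_convolution:
  assumes a: "0 < a" "a < 1" and st: "0 \<le> s" "s < t" "t \<le> T"
  shows "(\<integral>\<tau>. indicator {0..T} \<tau> * trunc_powr (a - 1) T (t - \<tau>) * trunc_powr (- a) T (\<tau> - s) \<partial>lborel) = Beta (1 - a) a"
proof -
  define f where "f \<sigma> = (if 0 < \<sigma> \<and> \<sigma> < 1 then \<sigma> powr (- a) * (1 - \<sigma>) powr (a - 1) else 0)" for \<sigma> :: real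
  have "has_bochner_integral lborel f (Beta (1 - a) a)"
  proof (rule has_bochner_integral_nonneg_has_integral)
    show "f \<in> borel_measurable borel" unfolding f_def by measurable
    have "((\<lambda>\<sigma>. if \<sigma> \<in> {0..1} then \<sigma> powr (1 - a - 1) * (1 - \<sigma>) powr (a - 1) else 0) has_integral Beta (1 - a) a) UNIV"
      by (rule iffD2[OF has_integral_restrict_UNIV has_integral_Beta_real]) (use a in auto)
    then show "(f has_integral Beta (1 - a) a) UNIV"
      by (rule has_integral_spike[of "{0, 1}", rotated 2]) (auto simp: f_def)
  qed (simp add: f_def)
  then have "has_bochner_integral lborel (\<lambda>\<tau>. f (- (s / (t - s)) + (1 / (t - s)) * \<tau>)) (Beta (1 - a) a /\<^sub>R \<bar>1 / (t - s)\<bar>)"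
    using st by (subst lborel_has_bochner_integral_real_affine_iff[symmetric]) auto
  then have "has_bochner_integral lborel (\<lambda>\<tau>. (1 / (t - s)) * f (- (s / (t - s)) + (1 / (t - s)) * \<tau>)) ((1 / (t - s)) * (Beta (1 - a) a /\<^sub>R \<bar>1 / (t - s)\<bar>))"
    by (rule has_bochner_integral_mult_right)
  also have "(\<lambda>\<tau>. (1 / (t - s)) * f (- (s / (t - s)) + (1 / (t - s)) * \<tau>)) = (\<lambda>\<tau>. indicator {0..T} \<tau> * trunc_powr (a - 1) T (t - \<tau>) * trunc_powr (- a) T (\<tau> - s))"
  proof
    fix \<tau>
    have \<sigma>: "- (s / (t - s)) + (1 / (t - s)) * \<tau> = (\<tau> - s) / (t - s)" by (simp add: diff_divide_distrib)
    have \<sigma>1: "1 - (\<tau> - s) / (t - s) = (t - \<tau>) / (t - s)" using st by (simp add: field_simps)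
    show "(1 / (t - s)) * f (- (s / (t - s)) + (1 / (t - s)) * \<tau>) = indicator {0..T} \<tau> * trunc_powr (a - 1) T (t - \<tau>) * trunc_powr (- a) T (\<tau> - s)"
    proof (cases "s < \<tau> \<and> \<tau> < t")
      case True
      have "(t - s) powr (- a) * (t - s) powr (a - 1) = 1 / (t - s)"
        using st powr_add[of "t - s" "- a" "a - 1"] by (simp add: powr_minus_divide)
      then have "1 / (t - s) * (((\<tau> - s) / (t - s)) powr (- a) * ((t - \<tau>) / (t - s)) powr (a - 1)) = (t - \<tau>) powr (a - 1) * (\<tau> - s) powr (- a)"
        using True st by (simp add: powr_divide field_simps)
      moreover have "0 < (\<tau> - s) / (t - s)" "(\<tau> - s) / (t - s) < 1" using True st by (auto simp: field_simps)
      ultimately show ?thesis unfolding \<sigma> f_def \<sigma>1 using True st by (simp add: trunc_powr_def)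
    next
      case False
      then have "\<not> (0 < (\<tau> - s) / (t - s) \<and> (\<tau> - s) / (t - s) < 1)" using st by (auto simp: field_simps zero_less_divide_iff)
      then show ?thesis unfolding \<sigma> f_def using False by (auto simp: trunc_powr_def)
    qed
  qed
  also have "(1 / (t - s)) * (Beta (1 - a) a /\<^sub>R \<bar>1 / (t - s)\<bar>) = Beta (1 - a) a" using st by (simp add: field_simps)
  finally show ?thesis by (rule has_bochner_integral_integral_eq)
qed

lemma fractional_equation_unique:
  fixes f :: "real \<Rightarrow> complex"
  assumes a: "0 < a" "a < 1" and T: "0 < T" and L: "0 < L" and fc: "continuous_on {0..T} f"
    and eq: "\<And>t. t \<in> {0..T} \<Longrightarrow> exp (\<i> * of_real (pi * a / 2)) *
      (\<integral>s. of_real (trunc_powr (- a) T (t - s)) * (indicator {0..T} s *\<^sub>R f s) \<partial>lborel) = of_real L * integral {0..t} f"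
    and t: "t \<in> {0..T}"
  shows "f t = 0"
proof -
  define \<theta> where "\<theta> = exp (\<i> * of_real (pi * a / 2))"
  have \<theta>1: "cmod \<theta> = 1" by (simp add: \<theta>_def)
  define F where "F t = integral {0..t} f" for t
  have Fc: "continuous_on {0..T} F" unfolding F_def
    by (rule indefinite_integral_continuous_1[OF integrable_continuous_real[OF fc]])
  define B where "B = Beta (1 - a) a"
  have B: "0 < B" using a by (simp add: B_def Beta_def Gamma_real_pos)
  have "set_integrable lborel {0..T} f" by (rule borel_integrable_atLeastAtMost'[OF fc])
  define ft where "ft s = indicator {0..T} s *\<^sub>R f s" for s
  have ftm[measurable]: "ft \<in> borel_measurable borel"
    using \<open>set_integrable lborel {0..T} f\<close> by (auto simp: set_integrable_def ft_def[abs_def])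
  obtain C where C: "\<And>s. cmod (ft s) \<le> C"
  proof -
    have "compact (f ` {0..T})" using fc by (intro compact_continuous_image) auto
    then obtain C where C: "\<forall>x\<in>f ` {0..T}. cmod x \<le> C" using compact_imp_bounded bounded_iff by metis
    have "cmod (f 0) \<le> C" using C T by simp
    then have "0 \<le> C" using norm_ge_zero order_trans by blast
    then have "cmod (ft s) \<le> C" for s using C by (simp add: ft_def indicator_def)
    then show ?thesis using that by blast
  qed
  have main: "\<theta> * (of_real B * F t) = of_real L * (\<integral>\<tau>. of_real (trunc_powr (a - 1) T (t - \<tau>)) * (indicator {0..T} \<tau> *\<^sub>R F \<tau>) \<partial>lborel)"
    if t: "t \<in> {0..T}" for t
  proof -
    define p :: "real \<Rightarrow> complex" where "p \<tau> = of_real (indicator {0..T} \<tau> * trunc_powr (a - 1) T (t - \<tau>))" for \<tau>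
    have "integrable lborel (\<lambda>\<tau>. trunc_powr (a - 1) T (t - \<tau>))"
      using lborel_integrable_real_affine[OF trunc_powr_integrable[of "a - 1" T], of "-1" t] a T by simp
    then have "integrable lborel (\<lambda>\<tau>. indicator {0..T} \<tau> *\<^sub>R trunc_powr (a - 1) T (t - \<tau>))"
      by (intro integrable_mult_indicator) auto
    then have p: "integrable lborel p" unfolding p_def by (subst complex_of_real_integrable_eq) simp
    define k :: "real \<Rightarrow> complex" where "k x = of_real (trunc_powr (- a) T (- x))" for x
    have k: "integrable lborel k"
      unfolding k_def using lborel_integrable_real_affine[OF trunc_powr_integrable[of "- a" T], of "-1" 0] a T by simp
    have "(\<integral>s. ft s * (\<integral>\<tau>. k (s - \<tau>) * p \<tau> \<partial>lborel) \<partial>lborel) = (\<integral>\<tau>. p \<tau> * (\<integral>s. ft s * k (s - \<tau>) \<partial>lborel) \<partial>lborel)"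
      by (rule Fubini_convolution[OF ftm C p k])
    also have "(\<lambda>s. ft s * (\<integral>\<tau>. k (s - \<tau>) * p \<tau> \<partial>lborel)) = (\<lambda>s. of_real B * (indicator {0..<t} s *\<^sub>R f s))"
    proof
      fix s
      have kp: "k (s - \<tau>) * p \<tau> = of_real (indicator {0..T} \<tau> * trunc_powr (a - 1) T (t - \<tau>) * trunc_powr (- a) T (\<tau> - s))" for \<tau>
        by (simp add: k_def p_def)
      have "(\<integral>\<tau>. k (s - \<tau>) * p \<tau> \<partial>lborel) = of_real (\<integral>\<tau>. indicator {0..T} \<tau> * trunc_powr (a - 1) T (t - \<tau>) * trunc_powr (- a) T (\<tau> - s) \<partial>lborel)"
        unfolding kp by (rule integral_complex_of_real)
      moreover have "(\<integral>\<tau>. indicator {0..T} \<tau> * trunc_powr (a - 1) T (t - \<tau>) * trunc_powr (- a) T (\<tau> - s) \<partial>lborel) = (if s < t then B else 0)" if "s \<in> {0..T}"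
      proof (cases "s < t")
        case True
        then show ?thesis using beta_convolution[OF a, of s t T] that t by (simp add: B_def)
      next
        case False
        then have "(\<lambda>\<tau>. indicator {0..T} \<tau> * trunc_powr (a - 1) T (t - \<tau>) * trunc_powr (- a) T (\<tau> - s)) = (\<lambda>\<tau>. 0)"
          by (auto simp: trunc_powr_def)
        then show ?thesis using False by simp
      qed
      ultimately show "ft s * (\<integral>\<tau>. k (s - \<tau>) * p \<tau> \<partial>lborel) = of_real B * (indicator {0..<t} s *\<^sub>R f s)"
        using t by (cases "s \<in> {0..T}") (auto simp: ft_def indicator_def)
    qed
    also have "(\<integral>s. of_real B * (indicator {0..<t} s *\<^sub>R f s) \<partial>lborel) = of_real B * F t"
    proof -
      have "(\<integral>s. indicator {0..<t} s *\<^sub>R f s \<partial>lborel) = (LBINT s:{0..t}. f s)"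
        unfolding set_lebesgue_integral_def
      proof (rule integral_cong_AE)
        show "AE s in lborel. indicator {0..<t} s *\<^sub>R f s = indicator {0..t} s *\<^sub>R f s"
          using AE_lborel_singleton[of t] by eventually_elim (auto simp: indicator_def)
        have "(\<lambda>s. indicator A s *\<^sub>R f s) = (\<lambda>s. indicator A s *\<^sub>R ft s)" if "A \<subseteq> {0..t}" for A
          using that t by (auto simp: ft_def indicator_def fun_eq_iff)
        moreover have "{0..<t} \<subseteq> {0..t}" by auto
        ultimately show "(\<lambda>s. indicator {0..<t} s *\<^sub>R f s) \<in> borel_measurable lborel" "(\<lambda>s. indicator {0..t} s *\<^sub>R f s) \<in> borel_measurable lborel"
          by auto
      qed
      also have "\<dots> = F t" unfolding F_def
        using t by (intro set_borel_integral_eq_integral(2) borel_integrable_atLeastAtMost' continuous_on_subset[OF fc]) auto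
      finally have "(\<integral>s. indicator {0..<t} s *\<^sub>R f s \<partial>lborel) = F t" .
      then show ?thesis by (simp only: integral_mult_right_zero)
    qed
    finally have "\<theta> * (of_real B * F t) = (\<integral>\<tau>. p \<tau> * (\<theta> * (\<integral>s. ft s * k (s - \<tau>) \<partial>lborel)) \<partial>lborel)"
      by (simp only: integral_mult_right_zero[symmetric] mult.left_commute)
    also have "\<dots> = (\<integral>\<tau>. of_real L * (of_real (trunc_powr (a - 1) T (t - \<tau>)) * (indicator {0..T} \<tau> *\<^sub>R F \<tau>)) \<partial>lborel)"
    proof (rule Bochner_Integration.integral_cong)
      fix \<tau>
      have "\<theta> * (\<integral>s. ft s * k (s - \<tau>) \<partial>lborel) = of_real L * F \<tau>" if "\<tau> \<in> {0..T}"
        using eq[OF that] by (simp add: \<theta>_def ft_def k_def F_def mult.commute)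
      then show "p \<tau> * (\<theta> * (\<integral>s. ft s * k (s - \<tau>) \<partial>lborel)) = of_real L * (of_real (trunc_powr (a - 1) T (t - \<tau>)) * (indicator {0..T} \<tau> *\<^sub>R F \<tau>))"
        by (cases "\<tau> \<in> {0..T}") (auto simp: p_def)
    qed simp
    finally show ?thesis by (simp only: integral_mult_right_zero)
  qed
  have F0: "F t = 0" if t: "t \<in> {0..T}" for t
  proof -
    have "cmod (F t) = 0"
    proof (rule volterra_gronwall[of a T "L / B", OF a(1) _ _ _ _ _ t])
      show "continuous_on {0..T} (\<lambda>t. cmod (F t))" by (intro continuous_intros Fc)
      fix t assume t: "t \<in> {0..T}"
      have "B * cmod (F t) = cmod (\<theta> * (of_real B * F t))" using B by (simp add: norm_mult \<theta>1)
      also have "\<dots> = L * cmod (\<integral>\<tau>. of_real (trunc_powr (a - 1) T (t - \<tau>)) * (indicator {0..T} \<tau> *\<^sub>R F \<tau>) \<partial>lborel)"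
        unfolding main[OF t] using L by (simp add: norm_mult)
      also have "\<dots> \<le> L * (\<integral>\<tau>. cmod (of_real (trunc_powr (a - 1) T (t - \<tau>)) * (indicator {0..T} \<tau> *\<^sub>R F \<tau>)) \<partial>lborel)"
        using L by (intro mult_left_mono integral_norm_bound) auto
      also have "(\<integral>\<tau>. cmod (of_real (trunc_powr (a - 1) T (t - \<tau>)) * (indicator {0..T} \<tau> *\<^sub>R F \<tau>)) \<partial>lborel) =
         (\<integral>\<tau>. trunc_powr (a - 1) T (t - \<tau>) * (indicator {0..T} \<tau> *\<^sub>R cmod (F \<tau>)) \<partial>lborel)"
        by (intro Bochner_Integration.integral_cong) (simp_all add: norm_mult trunc_powr_nonneg)
      finally show "cmod (F t) \<le> L / B * (\<integral>\<tau>. trunc_powr (a - 1) T (t - \<tau>) * (indicator {0..T} \<tau> *\<^sub>R cmod (F \<tau>)) \<partial>lborel)"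
        using B by (simp add: field_simps)
    qed (use T L B in auto)
    then show ?thesis by simp
  qed
  have zero: "f t = 0" if t: "t \<in> {0<..<T}" for t
  proof -
    have "(F has_vector_derivative f t) (at t within {0..T})"
      unfolding F_def using t by (intro integral_has_vector_derivative fc) auto
    then have "(F has_vector_derivative f t) (at t within {0<..<T})"
      by (rule has_vector_derivative_within_subset) auto
    then have "((\<lambda>t. 0) has_vector_derivative f t) (at t within {0<..<T})"
      by (rule has_vector_derivative_transform[rotated 2]) (use t F0 in auto)
    then have "((\<lambda>t. 0) has_vector_derivative f t) (at t)" using t by (subst (asm) at_within_open) auto
    moreover have "((\<lambda>t. 0) has_vector_derivative (0::complex)) (at t)" by simp
    ultimately show ?thesis using vector_derivative_unique_at by blast
  qed
  have "closure {0<..<T} = {0..T}" using T by (rule closure_greaterThanLessThan)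
  then show ?thesis
    using continuous_constant_on_closure[of "{0<..<T}" f 0 t] fc zero t by simp
qed

section \<open>Coefficients of the weak solution\<close>

lemma caputo_equation_integrated:
  fixes f :: "real \<Rightarrow> complex"
  assumes a: "0 < a" "a < 1" and T: "0 < T" and AC: "absolutely_continuous_fun_on 0 T f"
    and eq: "AE t in lebesgue. t \<in> {0<..<T} \<longrightarrow> (\<exists>d. has_caputo_derivative a f t d \<and> i_power a * d = of_real l * f t)"
    and t: "t \<in> {0..T}"
  shows "exp (\<i> * of_real (pi * a / 2)) *
      (\<integral>s. of_real (trunc_powr (- a) T (t - s)) * (indicator {0..T} s *\<^sub>R (f s - f 0)) \<partial>lborel)
    = of_real (l * Gamma (1 - a)) * integral {0..t} f"
proof -
  define \<theta> where "\<theta> = exp (\<i> * of_real (pi * a / 2))"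
  have ip: "i_power a = \<theta>" by (simp add: i_power_def \<theta>_def)
  have fc: "continuous_on {0..T} f" by (rule AC_imp_continuous_on[OF AC])
  have Gp: "0 < Gamma (1 - a)" using a by (intro Gamma_real_pos) simp
  obtain g where g: "integrable lborel g" "\<And>t. 0 \<le> t \<Longrightarrow> t \<le> T \<Longrightarrow> f t - f 0 = (LBINT s:{0..t}. g s)"
    using AC_complex_density[OF AC T] by metis
  have deriv: "AE s in lebesgue. s \<in> {0<..<T} \<longrightarrow> (f has_vector_derivative g s) (at s)"
    by (rule AE_indefinite_integral_derivative[OF g])
  have [measurable]: "g \<in> borel_measurable borel" using g(1) by auto
  define gt where "gt s = indicator {0..T} s *\<^sub>R g s" for s
  have gt: "integrable lborel gt" unfolding gt_def using g(1) by (intro integrable_mult_indicator) auto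
  have [measurable]: "gt \<in> borel_measurable borel" using gt by auto
  define k :: "real \<Rightarrow> complex" where "k x = of_real (trunc_powr (- a) T x)" for x
  have k: "integrable lborel k" unfolding k_def using trunc_powr_integrable[of "- a" T] a T by simp
  have [measurable]: "k \<in> borel_measurable borel" using k by auto
  have cap: "\<theta> * (\<integral>s. k (\<tau> - s) * gt s \<partial>lborel) = of_real (l * Gamma (1 - a)) * f \<tau>"
    if \<tau>: "\<tau> \<in> {0<..<T}" and d: "has_caputo_derivative a f \<tau> d" "i_power a * d = of_real l * f \<tau>" for \<tau> d
  proof -
    have si: "set_integrable lebesgue {0..\<tau>} (caputo_integrand a f \<tau>)"
      and dd: "d = (1 / Gamma (1 - a)) *\<^sub>R (LINT s:{0..\<tau>}|lebesgue. caputo_integrand a f \<tau> s)"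
      using d(1) by (auto simp: has_caputo_derivative_def)
    have "(LINT s:{0..\<tau>}|lebesgue. caputo_integrand a f \<tau> s) = (\<integral>s. k (\<tau> - s) * gt s \<partial>lebesgue)"
      unfolding set_lebesgue_integral_def
    proof (rule integral_cong_AE)
      show "(\<lambda>s. indicator {0..\<tau>} s *\<^sub>R caputo_integrand a f \<tau> s) \<in> borel_measurable lebesgue"
        using si by (auto simp: set_integrable_def)
      show "(\<lambda>s. k (\<tau> - s) * gt s) \<in> borel_measurable lebesgue"
        by (rule measurable_completion) measurable
      have "AE s in lebesgue. s \<noteq> \<tau>" "AE s in lebesgue. s \<noteq> 0"
        using AE_lborel_singleton by (auto intro: AE_completion)
      then show "AE s in lebesgue. indicator {0..\<tau>} s *\<^sub>R caputo_integrand a f \<tau> s = k (\<tau> - s) * gt s"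
        using deriv
      proof eventually_elim
        case (elim s)
        show ?case
        proof (cases "s \<in> {0..\<tau>}")
          case True
          then have "vector_derivative f (at s) = g s"
            using elim \<tau> by (intro vector_derivative_at) auto
          then show ?thesis using True elim \<tau> by (simp add: caputo_integrand_def k_def trunc_powr_def gt_def scaleR_conv_of_real)
        next
          case False
          then show ?thesis using \<tau> by (auto simp: k_def trunc_powr_def gt_def)
        qed
      qed
    qed
    also have "\<dots> = (\<integral>s. k (\<tau> - s) * gt s \<partial>lborel)" by (rule integral_completion) measurable
    finally have "of_real (Gamma (1 - a)) * d = (\<integral>s. k (\<tau> - s) * gt s \<partial>lborel)"
      using dd Gp by (simp add: scaleR_conv_of_real)
    then show ?thesis using d(2) unfolding ip by (metis mult.left_commute of_real_mult mult.assoc mult.commute)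
  qed
  define K where "K r = (\<integral>\<tau>. of_real (indicator {0..t} \<tau>) * k (\<tau> - r) \<partial>lborel)" for r
  have "of_real (l * Gamma (1 - a)) * integral {0..t} f = (\<integral>\<tau>. of_real (l * Gamma (1 - a)) * (indicator {0..t} \<tau> *\<^sub>R f \<tau>) \<partial>lborel)"
  proof -
    have "(LBINT s:{0..t}. f s) = integral {0..t} f"
      using t by (intro set_borel_integral_eq_integral(2) borel_integrable_atLeastAtMost' continuous_on_subset[OF fc]) auto
    then show ?thesis by (simp only: set_lebesgue_integral_def integral_mult_right_zero)
  qed
  also have "\<dots> = (\<integral>\<tau>. \<theta> * (of_real (indicator {0..t} \<tau>) * (\<integral>s. k (\<tau> - s) * gt s \<partial>lborel)) \<partial>lborel)"
  proof (rule integral_cong_AE)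
    have "set_integrable lborel {0..t} f"
      using t by (intro borel_integrable_atLeastAtMost' continuous_on_subset[OF fc]) auto
    then have [measurable]: "(\<lambda>\<tau>. indicator {0..t} \<tau> *\<^sub>R f \<tau>) \<in> borel_measurable borel"
      by (auto simp: set_integrable_def)
    show "(\<lambda>\<tau>. of_real (l * Gamma (1 - a)) * (indicator {0..t} \<tau> *\<^sub>R f \<tau>)) \<in> borel_measurable lborel" by measurable
    show "(\<lambda>\<tau>. \<theta> * (of_real (indicator {0..t} \<tau>) * (\<integral>s. k (\<tau> - s) * gt s \<partial>lborel))) \<in> borel_measurable lborel" by measurable
    have "AE \<tau> in lborel. \<tau> \<in> {0<..<T} \<longrightarrow> (\<exists>d. has_caputo_derivative a f \<tau> d \<and> i_power a * d = of_real l * f \<tau>)"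
      using eq by (simp add: AE_completion_iff)
    then show "AE \<tau> in lborel. of_real (l * Gamma (1 - a)) * (indicator {0..t} \<tau> *\<^sub>R f \<tau>) = \<theta> * (of_real (indicator {0..t} \<tau>) * (\<integral>s. k (\<tau> - s) * gt s \<partial>lborel))"
      using AE_lborel_singleton[of 0] AE_lborel_singleton[of T]
    proof eventually_elim
      case (elim \<tau>)
      show ?case
      proof (cases "\<tau> \<in> {0..t}")
        case True
        then have "\<tau> \<in> {0<..<T}" using elim t by auto
        then show ?thesis using elim(1) cap[of \<tau>] True by auto
      qed simp
    qed
  qed
  also have "\<dots> = \<theta> * (\<integral>\<tau>. of_real (indicator {0..t} \<tau>) * (\<integral>s. k (\<tau> - s) * gt s \<partial>lborel) \<partial>lborel)"
    by (simp only: integral_mult_right_zero)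
  also have "(\<integral>\<tau>. of_real (indicator {0..t} \<tau>) * (\<integral>s. k (\<tau> - s) * gt s \<partial>lborel) \<partial>lborel) = (\<integral>r. gt r * K r \<partial>lborel)"
    unfolding K_def by (rule Fubini_convolution[OF _ _ gt k, of _ 1]) (auto simp: indicator_def)
  also have "\<dots> = (\<integral>s. of_real (trunc_powr (- a) T (t - s)) * (indicator {0..T} s *\<^sub>R (f s - f 0)) \<partial>lborel)"
  proof -
    define p where "p s = indicator {0..T} s *\<^sub>R k (t - s)" for s
    have p: "integrable lborel p"
      unfolding p_def using lborel_integrable_real_affine[OF k, of "-1" t] by (intro integrable_mult_indicator) auto
    define \<iota> :: "real \<Rightarrow> real \<Rightarrow> complex" where "\<iota> s r = of_real (indicator {0..T} (s - r))" for s r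
    have \<iota>m: "case_prod \<iota> \<in> borel_measurable (borel \<Otimes>\<^sub>M borel)"
      unfolding \<iota>_def case_prod_unfold by measurable
    have "(\<integral>s. of_real (trunc_powr (- a) T (t - s)) * (indicator {0..T} s *\<^sub>R (f s - f 0)) \<partial>lborel) = (\<integral>s. p s * (\<integral>r. gt r * \<iota> s r \<partial>lborel) \<partial>lborel)"
    proof (rule Bochner_Integration.integral_cong)
      fix s
      have "f s - f 0 = (\<integral>r. gt r * \<iota> s r \<partial>lborel)" if s: "s \<in> {0..T}"
      proof -
        have "f s - f 0 = (\<integral>r. indicator {0..s} r *\<^sub>R g r \<partial>lborel)"
          using g(2)[of s] s by (simp add: set_lebesgue_integral_def)
        also have "\<dots> = (\<integral>r. gt r * \<iota> s r \<partial>lborel)"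
          using s by (intro Bochner_Integration.integral_cong) (auto simp: gt_def \<iota>_def indicator_def)
        finally show ?thesis .
      qed
      then show "of_real (trunc_powr (- a) T (t - s)) * (indicator {0..T} s *\<^sub>R (f s - f 0)) = p s * (\<integral>r. gt r * \<iota> s r \<partial>lborel)"
        by (cases "s \<in> {0..T}") (auto simp: p_def k_def)
    qed simp
    also have "\<dots> = (\<integral>r. gt r * (\<integral>s. p s * \<iota> s r \<partial>lborel) \<partial>lborel)"
      by (rule Fubini_bounded_kernel[OF p gt \<iota>m]) (auto simp: \<iota>_def indicator_def)
    also have "\<dots> = (\<integral>r. gt r * K r \<partial>lborel)"
    proof (rule Bochner_Integration.integral_cong)
      fix r
      have "(\<integral>s. p s * \<iota> s r \<partial>lborel) = K r" if r: "r \<in> {0..T}"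
      proof -
        have "(\<integral>s. p s * \<iota> s r \<partial>lborel) = (\<integral>\<tau>. p (t + r - \<tau>) * \<iota> (t + r - \<tau>) r \<partial>lborel)"
          using lborel_integral_real_affine[of "-1" "\<lambda>s. p s * \<iota> s r" "t + r"] by simp
        also have "\<dots> = K r" unfolding K_def
        proof (rule Bochner_Integration.integral_cong)
          fix \<tau> show "p (t + r - \<tau>) * \<iota> (t + r - \<tau>) r = of_real (indicator {0..t} \<tau>) * k (\<tau> - r)"
            using r t by (auto simp: p_def \<iota>_def k_def trunc_powr_def indicator_def)
        qed simp
        finally show ?thesis .
      qed
      then show "gt r * (\<integral>s. p s * \<iota> s r \<partial>lborel) = gt r * K r" by (cases "r \<in> {0..T}") (auto simp: gt_def)
    qed simp
    finally show ?thesis by simp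
  qed
  finally show ?thesis by (simp add: \<theta>_def)
qed

lemma scaleC_zero_left: "(0::complex) *\<^sub>C (x::'a::complex_hilbert) = 0"
  using scaleR_scaleC[of 0 x] by simp

lemma cinner_zero_left: "cinner (0::'a::complex_hilbert) y = 0"
  using cinner_scaleC_left[of 0 0 y] by (simp add: scaleC_zero_left)

lemma cinner_scaleC_right: "cinner (x::'a::complex_hilbert) (c *\<^sub>C y) = cnj c * cinner x y"
  by (metis cinner_commute cinner_scaleC_left complex_cnj_mult complex_cnj_cnj)

lemma eigenbasis_in_Hs:
  assumes "eigenbasis D A lam \<phi>"
  shows "\<phi> n \<in> Hs lam \<phi> s"
proof -
  have "cinner (\<phi> n) (\<phi> m) = (if n = m then 1 else 0)" for m
    using assms by (simp add: eigenbasis_def)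
  then have "summable (\<lambda>m. lam m powr (2 * s) * (cmod (cinner (\<phi> n) (\<phi> m)))\<^sup>2)"
    by (intro summable_finite[of "{n}"]) auto
  then show ?thesis by (simp add: Hs_def)
qed

lemma weak_solution_coefficient_equation:
  assumes eb: "eigenbasis D A lam \<phi>" and ws: "weak_solution A lam \<phi> \<alpha> T u0 u"
  shows "AE t in lebesgue. t \<in> {0<..<T} \<longrightarrow> (\<exists>d. has_caputo_derivative \<alpha> (\<lambda>\<tau>. cinner (u \<tau>) (\<phi> n)) t d \<and>
     i_power \<alpha> * d = of_real (lam n) * cinner (u t) (\<phi> n))"
proof -
  have ae: "AE t in lebesgue. t \<in> {0<..<T} \<longrightarrow>
        (\<exists>F. has_caputo_derivative_in_dual lam \<phi> (1 / \<alpha>) \<alpha> u t F \<and>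
             extended_op lam \<phi> (1 / \<alpha>) A (u t) \<in> Hs_dual lam \<phi> (1 / \<alpha>) \<and>
             (\<lambda>v. i_power \<alpha> * F v + extended_op lam \<phi> (1 / \<alpha>) A (u t) v) = (\<lambda>v. 0))"
    using ws by (simp add: weak_solution_def)
  then show ?thesis
  proof eventually_elim
    case (elim t)
    show ?case
    proof
      assume "t \<in> {0<..<T}"
      with elim obtain F where F: "has_caputo_derivative_in_dual lam \<phi> (1 / \<alpha>) \<alpha> u t F"
        and eq: "(\<lambda>v. i_power \<alpha> * F v + extended_op lam \<phi> (1 / \<alpha>) A (u t) v) = (\<lambda>v. 0)" by blast
      have "- A (\<phi> n) = lam n *\<^sub>R \<phi> n" using eb by (simp add: eigenbasis_def)
      then have "A (\<phi> n) = complex_of_real (- lam n) *\<^sub>C \<phi> n"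
        unfolding scaleR_scaleC[symmetric] by (metis minus_minus scaleR_minus_left)
      then have "extended_op lam \<phi> (1 / \<alpha>) A (u t) (\<phi> n) = - (of_real (lam n) * cinner (u t) (\<phi> n))"
        using eigenbasis_in_Hs[OF eb] by (simp add: extended_op_def cinner_scaleC_right)
      then have "i_power \<alpha> * F (\<phi> n) = of_real (lam n) * cinner (u t) (\<phi> n)"
        using fun_cong[OF eq, of "\<phi> n"] by simp
      then show "\<exists>d. has_caputo_derivative \<alpha> (\<lambda>\<tau>. cinner (u \<tau>) (\<phi> n)) t d \<and>
         i_power \<alpha> * d = of_real (lam n) * cinner (u t) (\<phi> n)"
        using F by (auto simp: has_caputo_derivative_in_dual_def)
    qed
  qed
qed

theorem theorem4p7:
  fixes D :: "'a::complex_hilbert set"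
    and A :: "'a \<Rightarrow> 'a"
    and lam :: "nat \<Rightarrow> real"
    and \<phi> :: "nat \<Rightarrow> 'a"
    and \<alpha> T :: real
    and u0 :: 'a
    and u :: "real \<Rightarrow> 'a"
  assumes "self_adjoint D A"
    and "negative_definite D A"
    and "compact_resolvent D A"
    and "eigenbasis D A lam \<phi>"
    and "0 < \<alpha>" and "\<alpha> < 1"
    and "0 < T"
    and "weak_solution A lam \<phi> \<alpha> T u0 u"
    and "u T = 0"
  shows "u0 = 0 \<and> (\<forall>t\<in>{0..T}. u t = 0)"
proof -
  note eb = \<open>eigenbasis D A lam \<phi>\<close> and \<alpha> = \<open>0 < \<alpha>\<close> \<open>\<alpha> < 1\<close> and T = \<open>0 < T\<close>
    and ws = \<open>weak_solution A lam \<phi> \<alpha> T u0 u\<close>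
  have coeff: "cinner (u t) (\<phi> n) = 0" if t: "t \<in> {0..T}" for t n
  proof -
    define f where "f \<tau> = cinner (u \<tau>) (\<phi> n)" for \<tau>
    have AC: "absolutely_continuous_fun_on 0 T f"
      using ws by (simp add: weak_solution_def f_def[abs_def])
    have fc: "continuous_on {0..T} f" by (rule AC_imp_continuous_on[OF AC])
    have "lam 0 \<le> lam n" using eb by (auto simp: eigenbasis_def intro: monoD)
    then have "0 < lam n" using eb by (auto simp: eigenbasis_def)
    then have L: "0 < lam n * Gamma (1 - \<alpha>)" using \<alpha> by (simp add: Gamma_real_pos)
    have eq: "exp (\<i> * of_real (pi * \<alpha> / 2)) *
      (\<integral>s. of_real (trunc_powr (- \<alpha>) T (t - s)) * (indicator {0..T} s *\<^sub>R (f s - f 0)) \<partial>lborel)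
      = of_real (lam n * Gamma (1 - \<alpha>)) * integral {0..t} f" if "t \<in> {0..T}" for t
      using weak_solution_coefficient_equation[OF eb ws, of n]
      by (intro caputo_equation_integrated[OF \<alpha> T AC _ that]) (simp add: f_def[abs_def])
    have "cmod (f 0) \<le> cmod (f T)" by (rule energy_estimate[OF \<alpha> T L fc eq])
    then have "f 0 = 0" using \<open>u T = 0\<close> by (simp add: f_def cinner_zero_left)
    then have "f t = 0" using eq by (intro fractional_equation_unique[OF \<alpha> T L fc _ t]) simp
    then show ?thesis by (simp add: f_def)
  qed
  have zero: "u t = 0" if t: "t \<in> {0..T}" for t
  proof -
    have "(\<lambda>n. cinner (u t) (\<phi> n) *\<^sub>C \<phi> n) sums u t" using eb by (simp add: eigenbasis_def)
    then have "(\<lambda>n. 0) sums u t" by (simp add: coeff[OF t] scaleC_zero_left)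
    then show ?thesis using sums_unique2 sums_zero by blast
  qed
  have "((\<lambda>t. norm (u t - u0)) \<longlongrightarrow> 0) (at_right 0)" using ws by (simp add: weak_solution_def)
  moreover have "\<forall>\<^sub>F t in at_right 0. norm (u t - u0) = norm u0"
    unfolding eventually_at_right_field using zero T by (intro exI[of _ T]) auto
  ultimately have "((\<lambda>t. norm u0) \<longlongrightarrow> 0) (at_right (0::real))" by (rule Lim_transform_eventually)
  then have "norm u0 = 0" by (simp add: tendsto_const_iff)
  then show ?thesis using zero by simp
qed

end
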